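(* The Fujishige-type decomposition algorithm (described in the context) computes a minimizer of the square-sum $W(x)=\sum_{s\in S}x(s)^2$ over an M-convex set $B\cap\mathbb{Z}^S$ (i.e. a decreasingly minimal element of $B\cap\mathbb{Z}^S$) in strongly polynomial time, where $B=B'(p)$ is the integral base-polyhedron defined by an integer-valued supermodular function $p$ on $S$.
   Context: $S$ is a finite non-empty set. For $x\in\mathbb{R}^S$ and $Z\subseteq S$, $\widetilde x(Z):=\sum_{s\in Z}x(s)$; $\chi_s$ is the unit vector of $s\in S$. A set-function $p:2^S\to\mathbb{Z}\cup\{-\infty\}$ with $p(\emptyset)=0$ is supermodular if $p(X)+p(Y)\le p(X\cap Y)+p(X\cup Y)$ for all $X,Y$ with finite $p$-values; $p(S)$ is assumed finite. $B'(p):=\{x\in\mathbb{R}^S:\widetilde x(S)=p(S),\ \widetilde x(Z)\ge p(Z)\text{ for every }Z\subset S\}$; the set $B\cap\mathbb{Z}^S$ is called an M-convex set. An element $m$ of a set $P$ of vectors is decreasingly minimal in $P$ if the vector of its components sorted in non-increasing order is lexicographically smallest among those of elements of $P$. Computational model: $p$ is accessed through an evaluation oracle, and a strongly polynomial submodular function minimization subroutine is available; "strongly polynomial time" means that the number of elementary arithmetic operations (including rounding) and oracle calls is bounded by a polynomial in $|S|$. For $S_+\subseteq S$, the restriction of $B$ to $S_+$ is $B'(p_+)$ on $S_+$, where $p_+(X):=p(X)$ for $X\subseteq S_+$. For $S_-\subseteq S$, the contraction of $B$ to $S_-$ is $B'(p_-)$ on $S_-$, where $p_-(X):=p(X\cup(S-S_-))-p(S-S_-)$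 for $X\subseteq S_-$. Fujishige-type decomposition algorithm on $B\cap\mathbb{Z}^S$: 1. Set $a:=\lfloor p(S)/|S|\rfloor$. 2. Find $z\in B\cap\mathbb{Z}^S$ such that for all $s,t\in S$: if $z(s)\le a$, $z(t)\ge a+1$ and $z(t)\ge z(s)+2$, then $z+\chi_s-\chi_t\notin B\cap\mathbb{Z}^S$. This is done by minimizing $\sum_{s\in S}\max(a-x(s),0,x(s)-a-1)$ over $x\in B\cap\mathbb{Z}^S$ as follows: write $x=x^1+x^2+x^3$ with integer vectors satisfying $x^1\le a\mathbf{1}$, $\mathbf{0}\le x^2\le\mathbf{1}$, $\mathbf{0}\le x^3$, regard $(x^1,x^2,x^3)$ as a vector on three disjoint copies of $S$ (the set of such triples with $x^1+x^2+x^3\in B\cap\mathbb{Z}^S$ is an M-convex set), and minimize the linear function $\sum_{s}(a-x^1(s))+\sum_s x^3(s)$ over this set. 3. Define $S_+:=\bigcup_{t\in S:\,z(t)\ge a+2}\{s\in S: z+\chi_s-\chi_t\in B\cap\mathbb{Z}^S\}$, $S_-:=\bigcup_{s\in S:\,z(s)\le a-1}\{t\in S: z+\chi_s-\chi_t\in B\cap\mathbb{Z}^S\}$, $S_0:=S-(S_+\cup S_-)$, and let $z^*(s):=z(s)$ for each $s\in S_0$. 4. If $S_+\ne\emptyset$, apply the algorithm recursively to the (integral points of the) restriction to $S_+$, which determines $z^*$ on $S_+$. If $S_-\ne\emptyset$, apply the algorithm recursively to the (integral points of the) contraction to $S_-$, which determines $z^*$ on $S_-$. 5. If both $S_+$ and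 $S_-$ are empty, stop. When the algorithm (with all its recursive calls) terminates, $z^*(s)$ is defined for all $s\in S$; this $z^*$ is the output. *)

theory Defs
  imports Complex_Main
    "HOL-Library.Multiset"
    "HOL-Library.Monad_Syntax"
    "HOL-Computational_Algebra.Polynomial"
begin

section \<open>Base-polyhedra and M-convex sets\<close>

text \<open>
  A set-function with values in the integers extended by minus infinity has type
  \<open>'s set \<Rightarrow> int option\<close>, where \<open>None\<close> is minus infinity. Only its values on subsets of the
  ground set matter. Likewise a vector indexed by \<open>S\<close> is a function on the whole type of which only
  the values on \<open>S\<close> matter.
\<close>

definition supermodular :: "'s set \<Rightarrow> ('s set \<Rightarrow> int option) \<Rightarrow> bool" where
  "supermodular S p \<longleftrightarrow> p {} = Some 0 \<and> p S \<noteq> None \<and>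
     (\<forall>X Y u v. X \<subseteq> S \<longrightarrow> Y \<subseteq> S \<longrightarrow> p X = Some u \<longrightarrow> p Y = Some v \<longrightarrow>
        (\<exists>k l. p (X \<inter> Y) = Some k \<and> p (X \<union> Y) = Some l \<and> u + v \<le> k + l))"

definition base_polyhedron :: "'s set \<Rightarrow> ('s set \<Rightarrow> int option) \<Rightarrow> ('s \<Rightarrow> real) set" where
  "base_polyhedron S p =
     {x. (\<exists>v. p S = Some v \<and> (\<Sum>s\<in>S. x s) = real_of_int v) \<and>
         (\<forall>Z v. Z \<subset> S \<longrightarrow> p Z = Some v \<longrightarrow> (\<Sum>s\<in>Z. x s) \<ge> real_of_int v)}"

definition mconvex_set :: "'s set \<Rightarrow> ('s set \<Rightarrow> int option) \<Rightarrow> ('s \<Rightarrow> int) set" where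
  "mconvex_set S p = {x. (\<lambda>s. real_of_int (x s)) \<in> base_polyhedron S p}"

definition sorted_decreasingly :: "'s set \<Rightarrow> ('s \<Rightarrow> int) \<Rightarrow> int list" where
  "sorted_decreasingly S x = rev (sorted_list_of_multiset (image_mset x (mset_set S)))"

definition decreasingly_minimal :: "'s set \<Rightarrow> ('s \<Rightarrow> int) set \<Rightarrow> ('s \<Rightarrow> int) \<Rightarrow> bool" where
  "decreasingly_minimal S P m \<longleftrightarrow> m \<in> P \<and>
     (\<forall>x\<in>P. sorted_decreasingly S m = sorted_decreasingly S x \<or>
            (sorted_decreasingly S m, sorted_decreasingly S x) \<in> lexord {(i, j). i < j})"

definition square_sum :: "'s set \<Rightarrow> ('s \<Rightarrow> int) \<Rightarrow> int" where
  "square_sum S x = (\<Sum>s\<in>S. (x s)\<^sup>2)"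

definition contraction ::
  "'s set \<Rightarrow> ('s set \<Rightarrow> int option) \<Rightarrow> 's set \<Rightarrow> 's set \<Rightarrow> int option" where
  "contraction S p T X = map_option (\<lambda>v. v - the (p (S - T))) (p (X \<union> (S - T)))"

section \<open>The decomposition algorithm as a nondeterministic procedure\<close>

text \<open>The vector \<open>z + \<chi>\<^sub>s - \<chi>\<^sub>t\<close>; for \<open>s = t\<close> it is \<open>z\<close>.\<close>

definition exchange :: "('s \<Rightarrow> int) \<Rightarrow> 's \<Rightarrow> 's \<Rightarrow> 's \<Rightarrow> int" where
  "exchange z s t = (\<lambda>r. z r + of_bool (r = s) - of_bool (r = t))"

definition step2_condition ::
  "'s set \<Rightarrow> ('s set \<Rightarrow> int option) \<Rightarrow> int \<Rightarrow> ('s \<Rightarrow> int) \<Rightarrow> bool" where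
  "step2_condition S p a z \<longleftrightarrow> z \<in> mconvex_set S p \<and>
     (\<forall>s\<in>S. \<forall>t\<in>S. z s \<le> a \<and> z t \<ge> a + 1 \<and> z t \<ge> z s + 2 \<longrightarrow>
        exchange z s t \<notin> mconvex_set S p)"

definition split_vectors ::
  "'s set \<Rightarrow> ('s set \<Rightarrow> int option) \<Rightarrow> int \<Rightarrow> (('s \<Rightarrow> int) \<times> ('s \<Rightarrow> int) \<times> ('s \<Rightarrow> int)) set" where
  "split_vectors S p a =
     {(x1, x2, x3). (\<lambda>s. x1 s + x2 s + x3 s) \<in> mconvex_set S p \<and>
        (\<forall>s\<in>S. x1 s \<le> a \<and> 0 \<le> x2 s \<and> x2 s \<le> 1 \<and> 0 \<le> x3 s)}"

definition step2_by_linear_minimization ::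
  "'s set \<Rightarrow> ('s set \<Rightarrow> int option) \<Rightarrow> int \<Rightarrow> ('s \<Rightarrow> int) \<Rightarrow> bool" where
  "step2_by_linear_minimization S p a z \<longleftrightarrow> step2_condition S p a z \<and>
     (\<exists>x1 x2 x3.
        is_arg_min (\<lambda>(x1, x2, x3). (\<Sum>s\<in>S. a - x1 s) + (\<Sum>s\<in>S. x3 s))
          (\<lambda>x. x \<in> split_vectors S p a) (x1, x2, x3) \<and>
        (\<forall>s\<in>S. z s = x1 s + x2 s + x3 s))"

definition S_plus :: "'s set \<Rightarrow> ('s set \<Rightarrow> int option) \<Rightarrow> int \<Rightarrow> ('s \<Rightarrow> int) \<Rightarrow> 's set" where
  "S_plus S p a z =
     (\<Union>t\<in>{t\<in>S. z t \<ge> a + 2}. {s\<in>S. exchange z s t \<in> mconvex_set S p})"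

definition S_minus :: "'s set \<Rightarrow> ('s set \<Rightarrow> int option) \<Rightarrow> int \<Rightarrow> ('s \<Rightarrow> int) \<Rightarrow> 's set" where
  "S_minus S p a z =
     (\<Union>s\<in>{s\<in>S. z s \<le> a - 1}. {t\<in>S. exchange z s t \<in> mconvex_set S p})"

text \<open>
  \<open>decomposition_output step2 S p z'\<close>: some terminating execution on the ground set \<open>S\<close> and the
  function \<open>p\<close> outputs \<open>z'\<close>, where \<open>step2 S p a z\<close> says which vectors \<open>z\<close> the second step may
  pick. The restriction to \<open>S\<^sub>+\<close> is given by \<open>p\<close> itself on the smaller ground set.
\<close>

inductive decomposition_output ::
  "('s set \<Rightarrow> ('s set \<Rightarrow> int option) \<Rightarrow> int \<Rightarrow> ('s \<Rightarrow> int) \<Rightarrow> bool) \<Rightarrow>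
   's set \<Rightarrow> ('s set \<Rightarrow> int option) \<Rightarrow> ('s \<Rightarrow> int) \<Rightarrow> bool"
  for step2 where
  "\<lbrakk> p S = Some v; a = \<lfloor>real_of_int v / real (card S)\<rfloor>;
     step2 S p a z;
     Sp = S_plus S p a z; Sm = S_minus S p a z;
     \<forall>s \<in> S - (Sp \<union> Sm). z' s = z s;
     Sp \<noteq> {} \<longrightarrow> decomposition_output step2 Sp p z';
     Sm \<noteq> {} \<longrightarrow> decomposition_output step2 Sm (contraction S p Sm) z' \<rbrakk>
   \<Longrightarrow> decomposition_output step2 S p z'"

section \<open>Computational model\<close>

text \<open>
  Programs are polymorphic in the type \<open>'v\<close> of numbers. They can therefore produce numbers only by
  evaluating expressions, and inspect them only by comparisons and by learning whether an evaluation
  was finite, so that no arithmetic escapes the cost count below.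
  Bookkeeping with elements and subsets of the ground set is not an arithmetic operation and is free.
  \<open>Div\<close> is division followed by rounding down; \<open>Query X\<close> is a call of the evaluation oracle.
\<close>

datatype ('v, 's) expr =
    Val 'v
  | Zero
  | One
  | Query "'s set"
  | Plus "('v, 's) expr" "('v, 's) expr"
  | Minus "('v, 's) expr" "('v, 's) expr"
  | Div "('v, 's) expr" "('v, 's) expr"

text \<open>
  \<open>Compute e k\<close> continues with the value of \<open>e\<close> (\<open>None\<close> if an infinite oracle value occurs),
  \<open>Leq x y k\<close> with the result of a comparison, and \<open>Sfm T f k\<close> with the answer of the subroutine
  for submodular function minimization on the function \<open>f\<close> over the subsets of \<open>T\<close>.
  \<open>Fail\<close> stands for getting stuck or not terminating.
\<close>

datatype ('v, 's, 'r) prog =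
    Ret 'r
  | Fail
  | Compute "('v, 's) expr" "'v option \<Rightarrow> ('v, 's, 'r) prog"
  | Leq 'v 'v "bool \<Rightarrow> ('v, 's, 'r) prog"
  | Sfm "'s set" "'s set \<Rightarrow> ('v, 's) expr" "'s set \<Rightarrow> ('v, 's, 'r) prog"

primrec bind_prog ::
  "('v, 's, 'r) prog \<Rightarrow> ('r \<Rightarrow> ('v, 's, 't) prog) \<Rightarrow> ('v, 's, 't) prog" where
  "bind_prog (Ret r) g = g r"
| "bind_prog Fail g = Fail"
| "bind_prog (Compute e k) g = Compute e (\<lambda>v. bind_prog (k v) g)"
| "bind_prog (Leq x y k) g = Leq x y (\<lambda>b. bind_prog (k b) g)"
| "bind_prog (Sfm T f k) g = Sfm T f (\<lambda>U. bind_prog (k U) g)"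

adhoc_overloading Monad_Syntax.bind \<rightleftharpoons> bind_prog

fun lift2 :: "(int \<Rightarrow> int \<Rightarrow> int) \<Rightarrow> int option \<Rightarrow> int option \<Rightarrow> int option" where
  "lift2 f (Some x) (Some y) = Some (f x y)"
| "lift2 f _ _ = None"

primrec expr_value :: "('s set \<Rightarrow> int option) \<Rightarrow> (int, 's) expr \<Rightarrow> int option" where
  "expr_value p (Val v) = Some v"
| "expr_value p Zero = Some 0"
| "expr_value p One = Some 1"
| "expr_value p (Query X) = p X"
| "expr_value p (Plus d e) = lift2 (+) (expr_value p d) (expr_value p e)"
| "expr_value p (Minus d e) = lift2 (-) (expr_value p d) (expr_value p e)"
| "expr_value p (Div d e) = lift2 (div) (expr_value p d) (expr_value p e)"

text \<open>The number of arithmetic operations and oracle calls.\<close>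

primrec expr_cost :: "('v, 's) expr \<Rightarrow> nat" where
  "expr_cost (Val v) = 0"
| "expr_cost Zero = 0"
| "expr_cost One = 0"
| "expr_cost (Query X) = 1"
| "expr_cost (Plus d e) = 1 + expr_cost d + expr_cost e"
| "expr_cost (Minus d e) = 1 + expr_cost d + expr_cost e"
| "expr_cost (Div d e) = 1 + expr_cost d + expr_cost e"

text \<open>
  A function that is to be minimized takes values in the integers extended by plus infinity, which
  is here \<open>None\<close> (for \<open>z - p\<close> it arises from \<open>p = -\<infinity>\<close>).
\<close>

definition submodular :: "'s set \<Rightarrow> ('s set \<Rightarrow> int option) \<Rightarrow> bool" where
  "submodular T f \<longleftrightarrow>
     (\<forall>X Y u v. X \<subseteq> T \<longrightarrow> Y \<subseteq> T \<longrightarrow> f X = Some u \<longrightarrow> f Y = Some v \<longrightarrow>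
        (\<exists>k l. f (X \<inter> Y) = Some k \<and> f (X \<union> Y) = Some l \<and> k + l \<le> u + v))"

definition minimizes_submodular :: "('s set \<Rightarrow> ('s set \<Rightarrow> int option) \<Rightarrow> 's set) \<Rightarrow> bool" where
  "minimizes_submodular sfm \<longleftrightarrow>
     (\<forall>T f. finite T \<longrightarrow> submodular T f \<longrightarrow> (\<exists>X\<subseteq>T. f X \<noteq> None) \<longrightarrow>
        sfm T f \<subseteq> T \<and>
        (\<exists>m. f (sfm T f) = Some m \<and> (\<forall>X v. X \<subseteq> T \<longrightarrow> f X = Some v \<longrightarrow> m \<le> v)))"

text \<open>
  \<open>exec p sfm q c\<close> yields the result of the program \<open>c\<close> and its cost. On a ground set of \<open>k\<close>
  elements the subroutine \<open>sfm\<close> uses at most \<open>poly q k\<close> arithmetic operations and at most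
  \<open>poly q k\<close> evaluations of the function it minimizes. It is charged this worst case, each
  evaluation at the cost of the most expensive one.
\<close>

primrec exec ::
  "('s set \<Rightarrow> int option) \<Rightarrow> ('s set \<Rightarrow> ('s set \<Rightarrow> int option) \<Rightarrow> 's set) \<Rightarrow> nat poly \<Rightarrow>
   (int, 's, 'r) prog \<Rightarrow> ('r \<times> nat) option" where
  "exec p sfm q (Ret r) = Some (r, 0)"
| "exec p sfm q Fail = None"
| "exec p sfm q (Compute e k) =
     map_option (\<lambda>(r, c). (r, expr_cost e + c)) (exec p sfm q (k (expr_value p e)))"
| "exec p sfm q (Leq x y k) =
     map_option (\<lambda>(r, c). (r, 1 + c)) (exec p sfm q (k (x \<le> y)))"
| "exec p sfm q (Sfm T f k) =
     map_option (\<lambda>(r, c). (r, poly q (card T) * (1 + Max ((\<lambda>X. expr_cost (f X)) ` Pow T)) + c))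
       (exec p sfm q (k (sfm T (\<lambda>X. expr_value p (f X)))))"

definition compute :: "('v, 's) expr \<Rightarrow> ('v, 's, 'v) prog" where
  "compute e = Compute e (\<lambda>v. case v of None \<Rightarrow> Fail | Some x \<Rightarrow> Ret x)"

definition leq :: "'v \<Rightarrow> 'v \<Rightarrow> ('v, 's, bool) prog" where
  "leq x y = Leq x y Ret"

definition minimizer :: "'s set \<Rightarrow> ('s set \<Rightarrow> ('v, 's) expr) \<Rightarrow> ('v, 's, 's set) prog" where
  "minimizer T f = Sfm T f Ret"

definition sum_expr :: "('e \<Rightarrow> ('v, 's) expr) \<Rightarrow> 'e list \<Rightarrow> ('v, 's) expr" where
  "sum_expr f es = foldr (\<lambda>e d. Plus (f e) d) es Zero"

primrec filter_prog :: "('e \<Rightarrow> ('v, 's, bool) prog) \<Rightarrow> 'e list \<Rightarrow> ('v, 's, 'e list) prog" where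
  "filter_prog c [] = Ret []"
| "filter_prog c (e # es) = do {
     b \<leftarrow> c e;
     fs \<leftarrow> filter_prog c es;
     Ret (if b then e # fs else fs)
   }"

primrec exists_prog :: "('e \<Rightarrow> ('v, 's, bool) prog) \<Rightarrow> 'e list \<Rightarrow> ('v, 's, bool) prog" where
  "exists_prog c [] = Ret False"
| "exists_prog c (e # es) = do {
     b \<leftarrow> c e;
     if b then Ret True else exists_prog c es
   }"

primrec vector_prog ::
  "('e \<Rightarrow> ('v, 's) expr) \<Rightarrow> 'e list \<Rightarrow> ('e \<Rightarrow> 'v) \<Rightarrow> ('v, 's, 'e \<Rightarrow> 'v) prog" where
  "vector_prog f [] x = Ret x"
| "vector_prog f (e # es) x = do {
     v \<leftarrow> compute (f e);
     vector_prog f es (x(e := v))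
   }"

section \<open>The decomposition algorithm as a program\<close>

text \<open>
  The ground set is given by a list \<open>xs\<close>, and \<open>ev X\<close> is the expression that evaluates at \<open>X\<close> the
  supermodular function of the current recursive call.

  Second step. A vector on three disjoint copies of \<open>S\<close> is indexed by pairs in \<open>copy \<times> S\<close>; the
  copies \<open>Low\<close>, \<open>Mid\<close>, \<open>High\<close> carry \<open>x\<^sup>1\<close>, \<open>x\<^sup>2\<close>, \<open>x\<^sup>3\<close>. The triples
  are the integral points of the base-polyhedron of
  \<open>P(Y\<^sub>1, Y\<^sub>2, Y\<^sub>3) = max {p(X) - a |X - Y\<^sub>1| - |X - Y\<^sub>2| : Y\<^sub>1 \<subseteq> X \<subseteq> Y\<^sub>3}\<close>,
  the usual formula for a base-polyhedron intersected with a box. With \<open>X = Y\<^sub>1 \<union> U\<close>, evaluating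
  \<open>P\<close> is a submodular minimization over the subsets \<open>U\<close> of \<open>Y\<^sub>3 - Y\<^sub>1\<close>. The linear objective has
  weights \<open>-1\<close>, \<open>0\<close>, \<open>1\<close> on the three copies and is minimized by the greedy algorithm, which
  goes through the elements by decreasing weight.
\<close>

datatype copy = Low | Mid | High

definition copy_part :: "copy \<Rightarrow> (copy \<times> 's) set \<Rightarrow> 's set" where
  "copy_part i Y = {s. (i, s) \<in> Y}"

definition split_function ::
  "'s list \<Rightarrow> ('s set \<Rightarrow> ('v, 's) expr) \<Rightarrow> 'v \<Rightarrow> (copy \<times> 's) set \<Rightarrow> ('v, 's, 'v) prog" where
  "split_function xs ev a Y =
     (let Y1 = copy_part Low Y; Y2 = copy_part Mid Y; Y3 = copy_part High Y;
          penalty = (\<lambda>U. Plus (sum_expr (\<lambda>_. Val a) (filter (\<lambda>s. s \<in> U) xs))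
                        (sum_expr (\<lambda>_. One) (filter (\<lambda>s. s \<in> Y1 \<union> U - Y2) xs)))
      in do {
        U \<leftarrow> minimizer (Y3 - Y1) (\<lambda>U. Minus (penalty U) (ev (Y1 \<union> U)));
        compute (Minus (ev (Y1 \<union> U)) (penalty U))
      })"

text \<open>
  \<open>greedy P Y w es x\<close> assigns the increments of \<open>P\<close> to the elements of \<open>es\<close>, in this order, when
  the elements of \<open>Y\<close> have already been treated and \<open>w\<close> is the value of \<open>P\<close> at \<open>Y\<close>.
\<close>

fun greedy ::
  "('e set \<Rightarrow> ('v, 's, 'v) prog) \<Rightarrow> 'e set \<Rightarrow> 'v \<Rightarrow> 'e list \<Rightarrow> ('e \<Rightarrow> 'v) \<Rightarrow>
   ('v, 's, 'e \<Rightarrow> 'v) prog" where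
  "greedy P Y w [] x = Ret x"
| "greedy P Y w (e # es) x = do {
     v \<leftarrow> P (insert e Y);
     d \<leftarrow> compute (Minus (Val v) (Val w));
     greedy P (insert e Y) v es (x(e := d))
   }"

definition step2_prog ::
  "'s list \<Rightarrow> ('s set \<Rightarrow> ('v, 's) expr) \<Rightarrow> 'v \<Rightarrow> ('v, 's, 's \<Rightarrow> 'v) prog" where
  "step2_prog xs ev a = do {
     zero \<leftarrow> compute Zero;
     x \<leftarrow> greedy (split_function xs ev a) {} zero
           (map (Pair High) xs @ map (Pair Mid) xs @ map (Pair Low) xs) (\<lambda>_. zero);
     vector_prog (\<lambda>s. Plus (Plus (Val (x (Low, s))) (Val (x (Mid, s)))) (Val (x (High, s))))
       xs (\<lambda>_. zero)
   }"

text \<open>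
  Membership of \<open>z + \<chi>\<^sub>s - \<chi>\<^sub>t\<close> in the M-convex set, for \<open>z\<close> in that set: the component sum is
  unchanged, so it remains to check that the minimum of \<open>y - p\<close> over all subsets is nonnegative,
  where \<open>y\<close> is the new vector.
\<close>

definition exchange_prog ::
  "'s list \<Rightarrow> ('s set \<Rightarrow> ('v, 's) expr) \<Rightarrow> ('s \<Rightarrow> 'v) \<Rightarrow> 's \<Rightarrow> 's \<Rightarrow> ('v, 's, bool) prog" where
  "exchange_prog xs ev z s t = do {
     zero \<leftarrow> compute Zero;
     i \<leftarrow> compute (Plus (Val (z s)) One);
     let z1 = z(s := i);
     d \<leftarrow> compute (Minus (Val (z1 t)) One);
     let y = z1(t := d);
     let f = (\<lambda>X. Minus (sum_expr (\<lambda>r. Val (y r)) (filter (\<lambda>r. r \<in> X) xs)) (ev X));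
     U \<leftarrow> minimizer (set xs) f;
     m \<leftarrow> compute (f U);
     leq zero m
   }"

text \<open>
  The two tests whether the ground set of a recursive call is smaller are not part of the algorithm:
  without them, a call on an unchanged ground set would recur forever.
  The contracted function is evaluated with \<open>p(S - S\<^sub>-)\<close> computed once and for all, so that the cost
  of an evaluation grows only by one operation with each nested contraction.
\<close>

fun decomposition_algorithm ::
  "'s list \<Rightarrow> ('s set \<Rightarrow> ('v, 's) expr) \<Rightarrow> ('v, 's, 's \<Rightarrow> 'v) prog" where
  "decomposition_algorithm xs ev = do {
     a \<leftarrow> compute (Div (ev (set xs)) (sum_expr (\<lambda>_. One) xs));
     z \<leftarrow> step2_prog xs ev a;
     hi \<leftarrow> compute (Plus (Plus (Val a) One) One);
     lo \<leftarrow> compute (Minus (Val a) One);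
     ts \<leftarrow> filter_prog (\<lambda>t. leq hi (z t)) xs;
     ss \<leftarrow> filter_prog (\<lambda>s. leq (z s) lo) xs;
     xsp \<leftarrow> filter_prog (\<lambda>s. exists_prog (\<lambda>t. exchange_prog xs ev z s t) ts) xs;
     xsm \<leftarrow> filter_prog (\<lambda>t. exists_prog (\<lambda>s. exchange_prog xs ev z s t) ss) xs;
     zp \<leftarrow> (if xsp = [] then Ret z
            else if length xsp < length xs then decomposition_algorithm xsp ev
            else Fail);
     zm \<leftarrow> (if xsm = [] then Ret z
            else if length xsm < length xs then do {
              w \<leftarrow> compute (ev (set xs - set xsm));
              decomposition_algorithm xsm
                (\<lambda>X. Minus (ev (X \<union> (set xs - set xsm))) (Val w))
            }
            else Fail);
     Ret (\<lambda>s. if s \<in> set xsp then zp s else if s \<in> set xsm then zm s else z s)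
   }"

declare decomposition_algorithm.simps [simp del]

end

theory Submission
  imports Defs
begin

text \<open>
  The idea is to reduce global optimality to a local condition: call a member \<open>z\<close> of the M-convex set
  balanced if no unit can be moved from a component to one that is smaller by at least two without
  leaving the set. An exchange is blocked only by a tight set, that is, a set on which \<open>z\<close> attains the
  lower bound \<open>p\<close>, and tight sets are closed under union and intersection. Hence for a balanced \<open>z\<close> and
  every level \<open>k\<close> there is a tight set between \<open>{z > k}\<close> and \<open>{z \<ge> k}\<close>, which gives
  \<open>\<Sum> max (z - k) 0 \<le> \<Sum> max (x - k) 0\<close> for every \<open>x\<close> in the set (\<open>balanced_majorized\<close>). These
  inequalities for all \<open>k\<close> express that \<open>x\<close> majorizes \<open>z\<close>. They imply that \<open>z\<close> minimizes the
  square-sum (\<open>balanced_minimizes_square_sum\<close>) and is decreasingly minimal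
  (\<open>balanced_decreasingly_minimal\<close>).

  It remains to see that the output is balanced. For the vector \<open>z\<close> of the second step, \<open>S\<^sub>+\<close> and
  \<open>S - S\<^sub>-\<close> are tight, \<open>z \<ge> a + 1\<close> on \<open>S\<^sub>+\<close>, \<open>z \<le> a\<close> on \<open>S\<^sub>-\<close>, and only the values \<open>a\<close> and
  \<open>a + 1\<close> occur elsewhere. The part of the polyhedron on which both sets are tight is a direct sum
  (\<open>mconvex_set_direct_sum\<close>), so the recursively computed vectors can be put together; being optimal,
  they satisfy the same bounds as \<open>z\<close>, and therefore no tightening exchange between different parts is
  possible (\<open>balanced_composition\<close>).

  For the program, the greedy algorithm on three copies of the ground set solves the second step:
  \<open>greedy_step\<close> is the usual argument that greedy vectors of supermodular functions are feasible, and
  \<open>greedy_splitting_optimal\<close> identifies the resulting vector as a minimizer. The two recursive ground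
  sets are disjoint by the bounds above, and proper subsets of \<open>S\<close> because \<open>a\<close> is the rounded average.
  Hence there are fewer than \<open>2 |S|\<close> calls in total, each of polynomial cost
  (\<open>halts_decomposition_algorithm\<close>).
\<close>

section \<open>Tight sets and exchanges\<close>

lemma mconvex_set_iff:
  "x \<in> mconvex_set S p \<longleftrightarrow>
     p S = Some (sum x S) \<and> (\<forall>Z v. Z \<subseteq> S \<longrightarrow> p Z = Some v \<longrightarrow> v \<le> sum x Z)"
proof -
  have real: "(\<Sum>s\<in>Z. real_of_int (x s)) = real_of_int (sum x Z)" for Z by simp
  show ?thesis
    unfolding mconvex_set_def base_polyhedron_def mem_Collect_eq real of_int_eq_iff of_int_le_iff
    by (metis option.inject order_refl psubset_eq)
qed

lemma mconvex_set_lower_bound: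
  assumes "x \<in> mconvex_set S p" "Z \<subseteq> S" "p Z = Some v"
  shows "v \<le> sum x Z"
  using assms by (simp add: mconvex_set_iff)

lemma mconvex_set_cong:
  assumes "\<forall>s\<in>S. x s = y s"
  shows "x \<in> mconvex_set S p \<longleftrightarrow> y \<in> mconvex_set S p"
proof -
  have "sum x Z = sum y Z" if "Z \<subseteq> S" for Z using assms that by (intro sum.cong) auto
  then show ?thesis unfolding mconvex_set_iff by auto
qed

lemma supermodularD:
  assumes "supermodular S p" "X \<subseteq> S" "Y \<subseteq> S" "p X = Some u" "p Y = Some v"
  shows "\<exists>k l. p (X \<inter> Y) = Some k \<and> p (X \<union> Y) = Some l \<and> u + v \<le> k + l"
  using assms unfolding supermodular_def by blast

definition tight :: "'s set \<Rightarrow> ('s set \<Rightarrow> int option) \<Rightarrow> ('s \<Rightarrow> int) \<Rightarrow> 's set \<Rightarrow> bool" where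
  "tight S p z T \<longleftrightarrow> T \<subseteq> S \<and> p T = Some (sum z T)"

lemma tight_Int_Un:
  assumes "finite S" "supermodular S p" "z \<in> mconvex_set S p" "tight S p z A" "tight S p z B"
  shows "tight S p z (A \<inter> B)" "tight S p z (A \<union> B)"
proof -
  have AB: "A \<subseteq> S" "B \<subseteq> S" "p A = Some (sum z A)" "p B = Some (sum z B)"
    using assms(4,5) by (auto simp: tight_def)
  then obtain k l where kl: "p (A \<inter> B) = Some k" "p (A \<union> B) = Some l" "sum z A + sum z B \<le> k + l"
    using supermodularD[OF assms(2)] by blast
  have "A \<inter> B \<subseteq> S" "A \<union> B \<subseteq> S" using AB by auto
  with assms(3) kl have le: "k \<le> sum z (A \<inter> B)" "l \<le> sum z (A \<union> B)"
    by (simp_all add: mconvex_set_lower_bound)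
  have "sum z (A \<union> B) + sum z (A \<inter> B) = sum z A + sum z B"
    using AB assms(1) by (intro sum.union_inter) (auto intro: finite_subset)
  with le kl(3) have "k = sum z (A \<inter> B)" "l = sum z (A \<union> B)" by linarith+
  with kl \<open>A \<inter> B \<subseteq> S\<close> \<open>A \<union> B \<subseteq> S\<close> show "tight S p z (A \<inter> B)" "tight S p z (A \<union> B)"
    by (auto simp: tight_def)
qed

lemma tight_Union:
  assumes "finite S" "supermodular S p" "z \<in> mconvex_set S p" "\<forall>T\<in>F. tight S p z T"
  shows "tight S p z (\<Union>F)"
proof -
  have "F \<subseteq> Pow S" using assms(4) by (auto simp: tight_def)
  then have "finite F" using assms(1) by (meson finite_Pow_iff finite_subset)
  then show ?thesis using assms(4)
  proof (induction F)
    case empty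
    then show ?case using assms(2) by (simp add: tight_def supermodular_def)
  next
    case (insert T F)
    then show ?case using tight_Int_Un(2)[OF assms(1-3)] by simp
  qed
qed

lemma tight_Inter:
  assumes "finite S" "supermodular S p" "z \<in> mconvex_set S p" "\<forall>T\<in>F. tight S p z T"
  shows "tight S p z (S \<inter> \<Inter>F)"
proof -
  have "F \<subseteq> Pow S" using assms(4) by (auto simp: tight_def)
  then have "finite F" using assms(1) by (meson finite_Pow_iff finite_subset)
  then show ?thesis using assms(4)
  proof (induction F)
    case empty
    then show ?case using assms(3) by (simp add: tight_def mconvex_set_iff)
  next
    case (insert T F)
    then have "tight S p z (T \<inter> (S \<inter> \<Inter>F))" using tight_Int_Un(1)[OF assms(1-3)] by simp
    moreover have "T \<inter> (S \<inter> \<Inter>F) = S \<inter> \<Inter>(insert T F)" by auto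
    ultimately show ?case by simp
  qed
qed

lemma sum_exchange:
  assumes "finite Z"
  shows "sum (exchange z s t) Z = sum z Z + of_bool (s \<in> Z) - of_bool (t \<in> Z)"
proof -
  have "(\<Sum>r\<in>Z. of_bool (r = u) :: int) = of_bool (u \<in> Z)" for u
    using assms by (simp add: of_bool_def)
  then show ?thesis by (simp add: exchange_def sum_subtractf sum.distrib)
qed

lemma exchange_same [simp]: "exchange z s s = z"
  by (simp add: exchange_def)

text \<open>
  An exchange changes component sums by at most one, so by integrality only tight sets can
  prevent it.
\<close>

lemma exchange_mem_iff:
  assumes "finite S" "z \<in> mconvex_set S p" "s \<in> S" "t \<in> S"
  shows "exchange z s t \<in> mconvex_set S p \<longleftrightarrow> (\<forall>T. tight S p z T \<longrightarrow> t \<in> T \<longrightarrow> s \<in> T)"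
proof
  assume L: "exchange z s t \<in> mconvex_set S p"
  show "\<forall>T. tight S p z T \<longrightarrow> t \<in> T \<longrightarrow> s \<in> T"
  proof (intro allI impI)
    fix T assume T: "tight S p z T" "t \<in> T"
    then have "sum z T \<le> sum (exchange z s t) T"
      using mconvex_set_lower_bound[OF L] by (simp add: tight_def)
    moreover have "finite T" using T assms(1) by (auto simp: tight_def intro: finite_subset)
    ultimately show "s \<in> T" using T(2) by (auto simp: sum_exchange split: if_splits)
  qed
next
  assume R: "\<forall>T. tight S p z T \<longrightarrow> t \<in> T \<longrightarrow> s \<in> T"
  have "v \<le> sum (exchange z s t) Z" if "Z \<subseteq> S" "p Z = Some v" for Z v
  proof -
    have fin: "finite Z" using that assms(1) finite_subset by blast
    have le: "v \<le> sum z Z" using mconvex_set_lower_bound[OF assms(2) that] .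
    show ?thesis
    proof (cases "tight S p z Z")
      case True
      then have "t \<in> Z \<longrightarrow> s \<in> Z" using R by blast
      then show ?thesis using le by (auto simp: sum_exchange[OF fin])
    next
      case False
      then have "v < sum z Z" using le that by (auto simp: tight_def)
      then show ?thesis by (auto simp: sum_exchange[OF fin])
    qed
  qed
  then show "exchange z s t \<in> mconvex_set S p"
    using assms unfolding mconvex_set_iff by (simp add: sum_exchange)
qed

text \<open>
  The elements that can receive a unit from \<open>t\<close> form the smallest tight set containing \<open>t\<close>. Dually, the
  elements that cannot give a unit to \<open>s\<close> form the largest tight set avoiding \<open>s\<close>.
\<close>

lemma tight_exchange_targets:
  assumes "finite S" "supermodular S p" "z \<in> mconvex_set S p" "t \<in> S"
  shows "tight S p z {s\<in>S. exchange z s t \<in> mconvex_set S p}"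
proof -
  have "{s\<in>S. exchange z s t \<in> mconvex_set S p} = S \<inter> \<Inter>{T. tight S p z T \<and> t \<in> T}"
    using assms by (auto simp: exchange_mem_iff)
  then show ?thesis using tight_Inter[OF assms(1-3), of "{T. tight S p z T \<and> t \<in> T}"] by simp
qed

lemma tight_exchange_sources:
  assumes "finite S" "supermodular S p" "z \<in> mconvex_set S p" "s \<in> S"
  shows "tight S p z (S - {t\<in>S. exchange z s t \<in> mconvex_set S p})"
proof -
  have "S - {t\<in>S. exchange z s t \<in> mconvex_set S p} = \<Union>{T. tight S p z T \<and> s \<notin> T}"
    using exchange_mem_iff[OF assms(1,3,4)] unfolding tight_def by blast
  then show ?thesis using tight_Union[OF assms(1-3), of "{T. tight S p z T \<and> s \<notin> T}"] by simp
qed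

lemma S_plus_subset: "S_plus S p a z \<subseteq> S" and S_minus_subset: "S_minus S p a z \<subseteq> S"
  by (auto simp: S_plus_def S_minus_def)

lemma tight_S_plus:
  assumes "finite S" "supermodular S p" "z \<in> mconvex_set S p"
  shows "tight S p z (S_plus S p a z)"
  unfolding S_plus_def
  by (rule tight_Union[OF assms]) (auto intro: tight_exchange_targets[OF assms])

lemma tight_complement_S_minus:
  assumes "finite S" "supermodular S p" "z \<in> mconvex_set S p"
  shows "tight S p z (S - S_minus S p a z)"
proof -
  let ?F = "(\<lambda>s. S - {t\<in>S. exchange z s t \<in> mconvex_set S p}) ` {s\<in>S. z s \<le> a - 1}"
  have "S - S_minus S p a z = S \<inter> \<Inter>?F" by (auto simp: S_minus_def)
  moreover have "tight S p z (S \<inter> \<Inter>?F)"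
    by (rule tight_Inter[OF assms]) (auto intro: tight_exchange_sources[OF assms])
  ultimately show ?thesis by simp
qed

text \<open>
  The large components lie in \<open>S\<^sub>+\<close> because of the trivial exchange with \<open>s = t\<close>. No component on \<open>S\<^sub>+\<close>
  is below \<open>a + 1\<close>, since the second step excludes an exchange from a component \<open>\<ge> a + 2\<close> to one
  \<open>\<le> a\<close>. The bounds for \<open>S\<^sub>-\<close> are symmetric.
\<close>

lemma S_plus_bounds:
  assumes "step2_condition S p a z" "s \<in> S"
  shows "z s \<ge> a + 2 \<Longrightarrow> s \<in> S_plus S p a z" "s \<in> S_plus S p a z \<Longrightarrow> z s \<ge> a + 1"
proof -
  note z = assms(1)[unfolded step2_condition_def, THEN conjunct1]
  note no = assms(1)[unfolded step2_condition_def, THEN conjunct2, rule_format, OF _ _ conjI, OF _ _ _ conjI]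
  show "s \<in> S_plus S p a z" if "z s \<ge> a + 2"
    unfolding S_plus_def using that assms(2) z by (intro UN_I[of s]) simp_all
  show "z s \<ge> a + 1" if s: "s \<in> S_plus S p a z"
  proof (rule ccontr)
    assume "\<not> z s \<ge> a + 1"
    moreover obtain t where "t \<in> S" "z t \<ge> a + 2" "exchange z s t \<in> mconvex_set S p"
      using s by (auto simp: S_plus_def)
    ultimately show False using no[of s t] assms(2) by linarith
  qed
qed

lemma S_minus_bounds:
  assumes "step2_condition S p a z" "s \<in> S"
  shows "z s \<le> a - 1 \<Longrightarrow> s \<in> S_minus S p a z" "s \<in> S_minus S p a z \<Longrightarrow> z s \<le> a"
proof -
  note z = assms(1)[unfolded step2_condition_def, THEN conjunct1]
  note no = assms(1)[unfolded step2_condition_def, THEN conjunct2, rule_format, OF _ _ conjI, OF _ _ _ conjI]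
  show "s \<in> S_minus S p a z" if "z s \<le> a - 1"
    unfolding S_minus_def using that assms(2) z by (intro UN_I[of s]) simp_all
  show "z s \<le> a" if s: "s \<in> S_minus S p a z"
  proof (rule ccontr)
    assume "\<not> z s \<le> a"
    moreover obtain r where "r \<in> S" "z r \<le> a - 1" "exchange z r s \<in> mconvex_set S p"
      using s by (auto simp: S_minus_def)
    ultimately show False using no[of r s] assms(2) by linarith
  qed
qed

lemma S_plus_S_minus_disjoint:
  assumes "step2_condition S p a z"
  shows "S_plus S p a z \<inter> S_minus S p a z = {}"
proof -
  have "s \<notin> S_minus S p a z" if s: "s \<in> S_plus S p a z" for s
  proof
    assume m: "s \<in> S_minus S p a z"
    have "s \<in> S" using s S_plus_subset by (rule subsetD[rotated])
    then show False
      using S_plus_bounds(2)[OF assms _ s] S_minus_bounds(2)[OF assms _ m] by linarith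
  qed
  then show ?thesis by (simp add: disjoint_iff)
qed

text \<open>
  If \<open>S\<^sub>+ = S\<close>, then all components of \<open>z\<close> are at least \<open>a + 1\<close>; if \<open>S\<^sub>- = S\<close>, then all are at
  most \<open>a\<close> and some are smaller. Either contradicts that \<open>a\<close> is the average rounded down.
\<close>

lemma S_plus_psubset:
  assumes "finite S" "S \<noteq> {}" "step2_condition S p a z" "p S = Some v"
    "a = \<lfloor>real_of_int v / real (card S)\<rfloor>"
  shows "S_plus S p a z \<subset> S"
proof (rule ccontr)
  assume "\<not> ?thesis"
  then have eq: "S_plus S p a z = S" using S_plus_subset[of S p a z] by blast
  have "\<forall>s\<in>S. z s \<ge> a + 1"
  proof
    fix s assume "s \<in> S"
    then show "z s \<ge> a + 1" using S_plus_bounds(2)[OF assms(3), of s] by (simp add: eq)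
  qed
  then have "(\<Sum>s\<in>S. a + 1) \<le> sum z S" by (intro sum_mono) auto
  moreover have "sum z S = v" using assms(3,4) by (simp add: step2_condition_def mconvex_set_iff)
  ultimately have "int (card S) * (a + 1) \<le> v" by simp
  moreover have "a = v div int (card S)"
    using assms(5) floor_divide_of_int_eq[of v "int (card S)"] by simp
  moreover have "int (card S) > 0" using assms(1,2) by (simp add: card_gt_0_iff)
  ultimately show False
    using zdiv_mono1[of "int (card S) * (a + 1)" v "int (card S)"] by simp
qed

lemma S_minus_psubset:
  assumes "finite S" "S \<noteq> {}" "step2_condition S p a z" "p S = Some v"
    "a = \<lfloor>real_of_int v / real (card S)\<rfloor>"
  shows "S_minus S p a z \<subset> S"
proof (rule ccontr)
  assume "\<not> ?thesis"
  then have eq: "S_minus S p a z = S" using S_minus_subset[of S p a z] by blast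
  then obtain s where "s \<in> S" "z s \<le> a - 1" using assms(2) unfolding S_minus_def by blast
  moreover have "\<forall>s\<in>S. z s \<le> a"
  proof
    fix s assume "s \<in> S"
    then show "z s \<le> a" using S_minus_bounds(2)[OF assms(3), of s] by (simp add: eq)
  qed
  ultimately have "sum z S < (\<Sum>s\<in>S. a)"
    by (intro sum_strict_mono_ex1[OF assms(1)]) (auto intro!: bexI[of _ s])
  moreover have "sum z S = v" using assms(3,4) by (simp add: step2_condition_def mconvex_set_iff)
  ultimately have "v < int (card S) * a" by simp
  moreover have "a = v div int (card S)"
    using assms(5) floor_divide_of_int_eq[of v "int (card S)"] by simp
  moreover have "int (card S) > 0" using assms(1,2) by (simp add: card_gt_0_iff)
  ultimately have "v < int (card S) * (v div int (card S))" "0 \<le> v mod int (card S)"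
    by simp_all
  then show False using mult_div_mod_eq[of "int (card S)" v] by linarith
qed

section \<open>Vectors without tightening exchanges are optimal\<close>

text \<open>
  Local optimality: moving a unit decreases the square-sum exactly if it goes to a component that is
  smaller by at least two.
\<close>

definition balanced :: "'s set \<Rightarrow> ('s set \<Rightarrow> int option) \<Rightarrow> ('s \<Rightarrow> int) \<Rightarrow> bool" where
  "balanced S p z \<longleftrightarrow> z \<in> mconvex_set S p \<and>
     (\<forall>s\<in>S. \<forall>t\<in>S. z t \<ge> z s + 2 \<longrightarrow> exchange z s t \<notin> mconvex_set S p)"

lemma balanced_step2_condition: "balanced S p z \<Longrightarrow> step2_condition S p a z"
  by (auto simp: balanced_def step2_condition_def)

text \<open>
  Some tight set \<open>C\<close> lies between \<open>{s. z s > k}\<close> and \<open>{s. z s \<ge> k}\<close>, so that the left-hand side is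
  \<open>z(C) - k |C| = p(C) - k |C| \<le> x(C) - k |C|\<close>.
\<close>

lemma balanced_majorized:
  assumes "finite S" "supermodular S p" "balanced S p z" "x \<in> mconvex_set S p"
  shows "(\<Sum>s\<in>S. max (z s - k) 0) \<le> (\<Sum>s\<in>S. max (x s - k) 0)"
proof -
  let ?C = "S_plus S p (k - 1) z"
  have z: "z \<in> mconvex_set S p" using assms(3) by (simp add: balanced_def)
  note bd = S_plus_bounds[OF balanced_step2_condition[OF assms(3)], of _ "k - 1"]
  have C: "?C \<subseteq> S" "p ?C = Some (sum z ?C)"
    using tight_S_plus[OF assms(1,2) z] by (auto simp: tight_def)
  have fin: "finite ?C" using C(1) assms(1) finite_subset by blast
  have "(\<Sum>s\<in>S. max (z s - k) 0) = (\<Sum>s\<in>?C. max (z s - k) 0)"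
    using C(1) assms(1) bd(1) by (intro sum.mono_neutral_right) force+
  also have "\<dots> = (\<Sum>s\<in>?C. z s - k)" using bd(2) C(1) by (intro sum.cong) force+
  also have "\<dots> = sum z ?C - (\<Sum>s\<in>?C. k)" by (rule sum_subtractf)
  also have "\<dots> \<le> sum x ?C - (\<Sum>s\<in>?C. k)"
    using assms(4) C unfolding mconvex_set_iff by simp
  also have "\<dots> = (\<Sum>s\<in>?C. x s - k)" by (rule sum_subtractf[symmetric])
  also have "\<dots> \<le> (\<Sum>s\<in>?C. max (x s - k) 0)" by (intro sum_mono) auto
  also have "\<dots> \<le> (\<Sum>s\<in>S. max (x s - k) 0)" using C(1) assms(1) by (intro sum_mono2) auto
  finally show ?thesis .
qed

text \<open>
  The next two lemmas apply majorization with \<open>k\<close> equal to the common bound \<open>b\<close>. One of the sums is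
  then linear or zero.
\<close>

lemma balanced_le:
  assumes "finite S" "supermodular S p" "balanced S p z" "x \<in> mconvex_set S p"
    "\<forall>s\<in>S. x s \<le> b" "s \<in> S"
  shows "z s \<le> b"
proof -
  have "(\<Sum>s\<in>S. max (x s - b) 0) = 0" using assms(5) by (intro sum.neutral) auto
  then have "(\<Sum>s\<in>S. max (z s - b) 0) \<le> 0" using balanced_majorized[OF assms(1-4), of b] by simp
  then have "(\<Sum>s\<in>S. max (z s - b) 0) = 0" by (meson antisym max.cobounded2 sum_nonneg)
  then have "max (z s - b) 0 = 0" using assms(1,6) by (simp add: sum_nonneg_eq_0_iff)
  then show ?thesis by simp
qed

lemma balanced_ge:
  assumes "finite S" "supermodular S p" "balanced S p z" "x \<in> mconvex_set S p"
    "\<forall>s\<in>S. x s \<ge> b" "s \<in> S"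
  shows "z s \<ge> b"
proof -
  have tot: "sum z S = sum x S" using assms(3,4) by (simp add: balanced_def mconvex_set_iff)
  have "(\<Sum>s\<in>S. max (x s - b) 0) = (\<Sum>s\<in>S. x s - b)" using assms(5) by (intro sum.cong) auto
  also have "\<dots> = (\<Sum>s\<in>S. z s - b)" using tot by (simp add: sum_subtractf)
  finally have "(\<Sum>s\<in>S. max (z s - b) 0) \<le> (\<Sum>s\<in>S. z s - b)"
    using balanced_majorized[OF assms(1-4), of b] by simp
  then have "(\<Sum>s\<in>S. max (z s - b) 0 - (z s - b)) \<le> 0" by (simp add: sum_subtractf)
  moreover have "0 \<le> (\<Sum>s\<in>S. max (z s - b) 0 - (z s - b))" by (intro sum_nonneg) auto
  ultimately have "(\<Sum>s\<in>S. max (z s - b) 0 - (z s - b)) = 0" by linarith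
  then have "max (z s - b) 0 - (z s - b) = 0"
    using assms(1,6) by (subst (asm) sum_nonneg_eq_0_iff) auto
  then show ?thesis by simp
qed

text \<open>
  The terms besides the last sum are affine in \<open>x\<close> and so add up to the same value for all vectors with
  the same total; the last sum is what majorization compares.
\<close>

lemma square_as_sum_of_hinges:
  fixes x m M :: int
  assumes "m \<le> x" "x \<le> M"
  shows "x\<^sup>2 = m\<^sup>2 + (2 * m + 1) * (x - m) + 2 * (\<Sum>k\<in>{m+1..M}. max (x - k) 0)"
  using assms
proof (induction x rule: int_ge_induct)
  case base
  have "(\<Sum>k\<in>{m+1..M}. max (m - k) 0) = 0" by (intro sum.neutral) auto
  then show ?case by simp
next
  case (step x)
  have "(\<Sum>k\<in>{m+1..M}. max (x + 1 - k) 0) = (\<Sum>k\<in>{m+1..M}. max (x - k) 0 + of_bool (k \<le> x))"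
    by (intro sum.cong) auto
  also have "\<dots> = (\<Sum>k\<in>{m+1..M}. max (x - k) 0) + (\<Sum>k\<in>{m+1..M}. of_bool (k \<le> x))"
    by (rule sum.distrib)
  also have "(\<Sum>k\<in>{m+1..M}. of_bool (k \<le> x)) = (\<Sum>k\<in>{m+1..x}. 1 :: int)"
    using step by (intro sum.mono_neutral_cong_right) auto
  also have "\<dots> = x - m" using step by simp
  finally show ?case using step by (simp add: power2_eq_square algebra_simps)
qed

lemma balanced_minimizes_square_sum:
  assumes "finite S" "supermodular S p" "balanced S p z"
  shows "is_arg_min (square_sum S) (\<lambda>x. x \<in> mconvex_set S p) z"
proof -
  have z: "z \<in> mconvex_set S p" using assms(3) by (simp add: balanced_def)
  have "square_sum S z \<le> square_sum S x" if x: "x \<in> mconvex_set S p" for x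
  proof -
    have "bdd_below (x ` S \<union> z ` S)" "bdd_above (x ` S \<union> z ` S)" using assms(1) by auto
    then obtain m M where "\<forall>v\<in>x ` S \<union> z ` S. m \<le> v" "\<forall>v\<in>x ` S \<union> z ` S. v \<le> M"
      unfolding bdd_below_def bdd_above_def by (elim exE)
    then have mM: "\<forall>s\<in>S. m \<le> x s \<and> m \<le> z s \<and> x s \<le> M \<and> z s \<le> M" by simp
    have eq: "square_sum S y = (\<Sum>s\<in>S. m\<^sup>2 + (2 * m + 1) * (y s - m))
        + 2 * (\<Sum>k\<in>{m+1..M}. \<Sum>s\<in>S. max (y s - k) 0)"
      if "\<forall>s\<in>S. m \<le> y s \<and> y s \<le> M" for y
    proof -
      have "square_sum S y =
          (\<Sum>s\<in>S. m\<^sup>2 + (2 * m + 1) * (y s - m) + 2 * (\<Sum>k\<in>{m+1..M}. max (y s - k) 0))"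
        unfolding square_sum_def using that
        by (intro sum.cong refl square_as_sum_of_hinges) auto
      also have "\<dots> = (\<Sum>s\<in>S. m\<^sup>2 + (2 * m + 1) * (y s - m))
          + 2 * (\<Sum>s\<in>S. \<Sum>k\<in>{m+1..M}. max (y s - k) 0)"
        by (simp only: sum.distrib sum_distrib_left)
      also have "(\<Sum>s\<in>S. \<Sum>k\<in>{m+1..M}. max (y s - k) 0) =
          (\<Sum>k\<in>{m+1..M}. \<Sum>s\<in>S. max (y s - k) 0)" by (rule sum.swap)
      finally show ?thesis .
    qed
    have "(\<Sum>s\<in>S. m\<^sup>2 + (2 * m + 1) * (y s - m)) =
        (\<Sum>s\<in>S. m\<^sup>2) + (2 * m + 1) * (sum y S - (\<Sum>s\<in>S. m))" for y
      by (simp only: sum.distrib sum_distrib_left[symmetric] sum_subtractf)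
    moreover have "sum z S = sum x S" using x z by (simp add: mconvex_set_iff)
    moreover have "(\<Sum>k\<in>{m+1..M}. \<Sum>s\<in>S. max (z s - k) 0) \<le> (\<Sum>k\<in>{m+1..M}. \<Sum>s\<in>S. max (x s - k) 0)"
      by (rule sum_mono) (rule balanced_majorized[OF assms x])
    ultimately show ?thesis using mM by (simp add: eq)
  qed
  then show ?thesis using z by (auto simp: is_arg_min_linorder)
qed

text \<open>
  At the first difference, if the left entry \<open>u\<close> were the larger one, then the sums for \<open>k = u - 1\<close>
  would compare the wrong way: from there on only the left list has an entry above \<open>k\<close>.
\<close>

lemma majorized_imp_lexord:
  fixes l l' :: "int list"
  assumes "length l = length l'" "sorted_wrt (\<ge>) l" "sorted_wrt (\<ge>) l'"
    "\<And>k. (\<Sum>v\<leftarrow>l. max (v - k) 0) \<le> (\<Sum>v\<leftarrow>l'. max (v - k) 0)"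
  shows "l = l' \<or> (l, l') \<in> lexord {(i, j). i < j}"
  using assms
proof (induction l l' rule: list_induct2)
  case (Cons u l v l')
  consider "u < v" | "u = v" | "u > v" by linarith
  then show ?case
  proof cases
    case 2
    then have "\<And>k. (\<Sum>v\<leftarrow>l. max (v - k) 0) \<le> (\<Sum>v\<leftarrow>l'. max (v - k) 0)" using Cons.prems(3) by simp
    then show ?thesis using Cons 2 by auto
  next
    case 3
    then have "\<forall>w\<in>set (v # l'). max (w - (u - 1)) 0 = 0" using Cons.prems(2) by auto
    then have "map (\<lambda>w. max (w - (u - 1)) 0) (v # l') = map (\<lambda>_. 0) (v # l')"
      by (intro map_cong) auto
    then have "(\<Sum>w\<leftarrow>v # l'. max (w - (u - 1)) 0) = 0" by (simp only: sum_list_0)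
    moreover have "(\<Sum>w\<leftarrow>u # l. max (w - (u - 1)) 0) \<ge> 1 + 0"
      by (simp only: list.map sum_list.Cons) (intro add_mono sum_list_nonneg, auto)
    ultimately show ?thesis using Cons.prems(3)[of "u - 1"] by linarith
  qed simp
qed simp

lemma balanced_decreasingly_minimal:
  assumes "finite S" "supermodular S p" "balanced S p z"
  shows "decreasingly_minimal S (mconvex_set S p) z"
proof -
  have mset: "mset (sorted_decreasingly S y) = image_mset y (mset_set S)" for y
    by (simp add: sorted_decreasingly_def)
  have sums: "(\<Sum>v\<leftarrow>sorted_decreasingly S y. max (v - k) 0) = (\<Sum>s\<in>S. max (y s - k) 0)" for y k
  proof -
    have "(\<Sum>v\<leftarrow>sorted_decreasingly S y. max (v - k) 0) =
        sum_mset (image_mset (\<lambda>v. max (v - k) 0) (mset (sorted_decreasingly S y)))"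
      by (simp flip: mset_map add: sum_mset_sum_list)
    also have "\<dots> = sum_mset (image_mset (\<lambda>s. max (y s - k) 0) (mset_set S))"
      by (simp add: mset image_mset.compositionality comp_def)
    finally show ?thesis by (simp add: sum_unfold_sum_mset)
  qed
  have len: "length (sorted_decreasingly S y) = card S" for y
    by (metis mset size_image_mset size_mset size_mset_set)
  have sorted: "sorted_wrt (\<ge>) (sorted_decreasingly S y)" for y
    by (simp add: sorted_decreasingly_def sorted_wrt_rev)
  show ?thesis
    unfolding decreasingly_minimal_def
  proof (intro conjI ballI)
    show "z \<in> mconvex_set S p" using assms(3) by (simp add: balanced_def)
    fix x assume "x \<in> mconvex_set S p"
    then show "sorted_decreasingly S z = sorted_decreasingly S x \<or>
        (sorted_decreasingly S z, sorted_decreasingly S x) \<in> lexord {(i, j). i < j}"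
      using balanced_majorized[OF assms] by (intro majorized_imp_lexord) (simp_all add: len sorted sums)
  qed
qed

section \<open>Restriction and contraction\<close>

lemma supermodular_restriction:
  assumes "supermodular S p" "C \<subseteq> S" "p C \<noteq> None"
  shows "supermodular C p"
  using assms unfolding supermodular_def by (meson subset_trans)

lemma contraction_eq_Some:
  assumes "p (S - T) = Some w"
  shows "contraction S p T X = Some k \<longleftrightarrow> p (X \<union> (S - T)) = Some (k + w)"
  using assms by (auto simp: contraction_def)

lemma supermodular_contraction:
  assumes "supermodular S p" "T \<subseteq> S" "p (S - T) = Some w"
  shows "supermodular T (contraction S p T)"
proof -
  have TS: "T \<union> S = S" using assms(2) by blast
  have "\<exists>k l. contraction S p T (X \<inter> Y) = Some k \<and> contraction S p T (X \<union> Y) = Some l \<and> u + v \<le> k + l"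
    if "X \<subseteq> T" "Y \<subseteq> T" "contraction S p T X = Some u" "contraction S p T Y = Some v" for X Y u v
  proof -
    let ?D = "S - T"
    have "p (X \<union> ?D) = Some (u + w)" "p (Y \<union> ?D) = Some (v + w)" "X \<union> ?D \<subseteq> S" "Y \<union> ?D \<subseteq> S"
      using that assms by (auto simp: contraction_eq_Some[of p, OF assms(3)])
    then obtain k l where "p ((X \<union> ?D) \<inter> (Y \<union> ?D)) = Some k" "p ((X \<union> ?D) \<union> (Y \<union> ?D)) = Some l"
      "u + w + (v + w) \<le> k + l"
      using supermodularD[OF assms(1)] by blast
    moreover have "(X \<union> ?D) \<inter> (Y \<union> ?D) = X \<inter> Y \<union> ?D" "(X \<union> ?D) \<union> (Y \<union> ?D) = X \<union> Y \<union> ?D" by auto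
    ultimately show ?thesis
      by (intro exI[of _ "k - w"] exI[of _ "l - w"]) (simp add: contraction_eq_Some[of p, OF assms(3)])
  qed
  moreover have "contraction S p T {} = Some 0" "contraction S p T T \<noteq> None"
    using assms(1,3) by (simp_all add: supermodular_def contraction_def TS)
  ultimately show ?thesis unfolding supermodular_def by blast
qed

text \<open>
  Supermodularity for \<open>Z\<close> and \<open>D\<close> splits the constraint for \<open>Z\<close> into one for \<open>Z \<inter> D\<close> on \<open>D\<close> and one
  for \<open>Z - D\<close> in the contraction. So the face of the base-polyhedron on which \<open>D\<close> is tight is a direct
  sum.
\<close>

lemma mconvex_set_direct_sum:
  assumes "finite S" "supermodular S p" "D \<subseteq> S"
  shows "y \<in> mconvex_set S p \<and> tight S p y D \<longleftrightarrow>
    y \<in> mconvex_set D p \<and> y \<in> mconvex_set (S - D) (contraction S p (S - D))"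
proof -
  have SD: "S - (S - D) = D" "S \<union> D = S" using assms(3) by auto
  have fin: "finite Z" if "Z \<subseteq> S" for Z using that assms(1) finite_subset by blast
  have sum_S: "sum y S = sum y D + sum y (S - D)"
    using assms(1,3) by (metis add.commute sum.subset_diff)
  show ?thesis
  proof
    assume L: "y \<in> mconvex_set S p \<and> tight S p y D"
    then have D: "p D = Some (sum y D)" by (simp add: tight_def)
    have le: "v \<le> sum y Z" if "Z \<subseteq> S" "p Z = Some v" for Z v
      using mconvex_set_lower_bound[OF conjunct1[OF L] that] .
    have "v \<le> sum y Z" if "Z \<subseteq> S - D" "contraction S p (S - D) Z = Some v" for Z v
    proof -
      have "p (Z \<union> D) = Some (v + sum y D)"
        using that(2) contraction_eq_Some[of p S "S - D"] D by (simp add: SD)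
      then have "v + sum y D \<le> sum y (Z \<union> D)" using that(1) assms(3) by (intro le) auto
      moreover have "sum y (Z \<union> D) = sum y Z + sum y D"
        using that(1) assms(3) by (intro sum.union_disjoint) (auto intro: fin)
      ultimately show ?thesis by simp
    qed
    moreover have "p S = Some (sum y (S - D) + sum y D)"
      using L sum_S by (simp add: mconvex_set_iff)
    then have "contraction S p (S - D) (S - D) = Some (sum y (S - D))"
      using contraction_eq_Some[of p S "S - D"] D by (simp add: SD)
    ultimately show "y \<in> mconvex_set D p \<and> y \<in> mconvex_set (S - D) (contraction S p (S - D))"
      using le D assms(3) unfolding mconvex_set_iff by auto
  next
    assume R: "y \<in> mconvex_set D p \<and> y \<in> mconvex_set (S - D) (contraction S p (S - D))"
    then have D: "p D = Some (sum y D)" by (simp add: mconvex_set_iff)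
    note contr = contraction_eq_Some[of p S "S - D", unfolded SD, OF D]
    have "p S = Some (sum y S)"
      using R sum_S by (simp add: mconvex_set_iff contr SD)
    moreover have "u \<le> sum y Z" if Z: "Z \<subseteq> S" "p Z = Some u" for Z u
    proof -
      obtain k l where kl: "p (Z \<inter> D) = Some k" "p (Z \<union> D) = Some l" "u + sum y D \<le> k + l"
        using supermodularD[OF assms(2) Z(1) assms(3) Z(2) D] by (elim exE conjE)
      have "k \<le> sum y (Z \<inter> D)"
        using mconvex_set_lower_bound[OF conjunct1[OF R]] kl(1) by simp
      moreover have "contraction S p (S - D) (Z - D) = Some (l - sum y D)"
        using kl(2) by (simp add: contr)
      then have "l - sum y D \<le> sum y (Z - D)"
        using Z(1) by (intro mconvex_set_lower_bound[OF conjunct2[OF R]]) auto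
      moreover have "sum y Z = sum y (Z \<inter> D) + sum y (Z - D)"
        using fin[OF Z(1)] by (rule sum.Int_Diff)
      ultimately show ?thesis using kl(3) by linarith
    qed
    ultimately show "y \<in> mconvex_set S p \<and> tight S p y D"
      using D assms(3) by (simp add: mconvex_set_iff tight_def)
  qed
qed

section \<open>The decomposition\<close>

lemma supermodular_S_plus:
  assumes "finite S" "supermodular S p" "step2_condition S p a z"
  shows "supermodular (S_plus S p a z) p"
proof -
  have "tight S p z (S_plus S p a z)"
    using assms by (intro tight_S_plus) (simp_all add: step2_condition_def)
  then show ?thesis using supermodular_restriction[OF assms(2)] by (simp add: tight_def)
qed

lemma finite_value_complement_S_minus:
  assumes "finite S" "supermodular S p" "step2_condition S p a z"
  shows "\<exists>w. p (S - S_minus S p a z) = Some w"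
proof -
  have "tight S p z (S - S_minus S p a z)"
    using assms by (intro tight_complement_S_minus) (simp_all add: step2_condition_def)
  then show ?thesis by (simp add: tight_def)
qed

lemma supermodular_contraction_S_minus:
  assumes "finite S" "supermodular S p" "step2_condition S p a z"
  shows "supermodular (S_minus S p a z) (contraction S p (S_minus S p a z))"
  using finite_value_complement_S_minus[OF assms] supermodular_contraction[OF assms(2) S_minus_subset]
  by (elim exE)

text \<open>
  Write \<open>C\<close> for \<open>S\<^sub>+\<close> and \<open>M\<close> for \<open>S\<^sub>-\<close>. As \<open>C\<close> and \<open>S - M\<close> are tight for \<open>z\<close>, the face of
  the polyhedron on which both are tight is the direct sum of three base-polyhedra, so \<open>y\<close> lies in it.
  Optimality on \<open>C\<close> and \<open>M\<close> transfers the bounds \<open>z \<ge> a + 1\<close> on \<open>C\<close> and \<open>z \<le> a\<close> on \<open>M\<close> from \<open>z\<close> to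
  \<open>y\<close>; outside, both vectors take only the values \<open>a\<close> and \<open>a + 1\<close>. A tightening exchange of \<open>y\<close>
  must therefore move a unit within \<open>C\<close>, within \<open>M\<close>, or across one of the two tight sets, out of it.
  The first two are excluded by assumption and the last one by tightness.
\<close>

lemma balanced_composition:
  assumes fin: "finite S" and sm: "supermodular S p" and st: "step2_condition S p a z"
    and C: "C = S_plus S p a z" and M: "M = S_minus S p a z"
    and rest: "\<forall>s\<in>S - (C \<union> M). y s = z s"
    and bC: "balanced C p y" and bM: "balanced M (contraction S p M) y"
  shows "balanced S p y"
proof -
  define D where "D = S - M"
  have sub: "C \<subseteq> D" "D \<subseteq> S" "M \<subseteq> S" "C \<subseteq> S" "S - D = M"
    using S_plus_subset[of S p a z] S_minus_subset[of S p a z] S_plus_S_minus_disjoint[OF st]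
    by (auto simp: D_def C M)
  have finD: "finite D" "finite C" "finite M" using fin sub by (auto intro: finite_subset)
  have z: "z \<in> mconvex_set S p" using st by (simp add: step2_condition_def)
  have tC: "tight S p z C" unfolding C by (rule tight_S_plus[OF fin sm z])
  have tD: "tight S p z D" unfolding D_def M by (rule tight_complement_S_minus[OF fin sm z])
  note sumS = mconvex_set_direct_sum[OF fin sm \<open>D \<subseteq> S\<close>, unfolded \<open>S - D = M\<close>]
  have zD: "z \<in> mconvex_set D p" and zM: "z \<in> mconvex_set M (contraction S p M)"
    using sumS[of z] z tD by simp_all
  have smD: "supermodular D p"
    using supermodular_restriction[OF sm \<open>D \<subseteq> S\<close>] tD by (simp add: tight_def)
  note sumD = mconvex_set_direct_sum[OF finD(1) smD \<open>C \<subseteq> D\<close>]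
  have zC: "z \<in> mconvex_set C p" and z0: "z \<in> mconvex_set (D - C) (contraction D p (D - C))"
    using sumD[of z] zD tC sub by (simp_all add: tight_def)
  have y_eq: "y s = z s" if "s \<in> D - C" for s using rest that by (auto simp: D_def)
  have "y \<in> mconvex_set (D - C) (contraction D p (D - C))"
    using z0 y_eq mconvex_set_cong[of "D - C" y z] by simp
  then have yD: "y \<in> mconvex_set D p" and tyC: "tight D p y C"
    using bC sumD[of y] by (simp_all add: balanced_def)
  then have y: "y \<in> mconvex_set S p" and tyD: "tight S p y D"
    using bM sumS[of y] by (simp_all add: balanced_def)
  have tyCS: "tight S p y C" using tyC sub by (simp add: tight_def)
  have "\<forall>s\<in>C. z s \<ge> a + 1"
  proof
    fix s assume "s \<in> C"
    then show "z s \<ge> a + 1" using S_plus_bounds(2)[OF st] sub(4) unfolding C by (simp add: subsetD)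
  qed
  then have geC: "y s \<ge> a + 1" if "s \<in> C" for s
    using balanced_ge[OF finD(2) _ bC zC _ that] supermodular_S_plus[OF fin sm st] by (simp add: C)
  have "\<forall>s\<in>M. z s \<le> a"
  proof
    fix s assume "s \<in> M"
    then show "z s \<le> a" using S_minus_bounds(2)[OF st] sub(3) unfolding M by (simp add: subsetD)
  qed
  then have leM: "y s \<le> a" if "s \<in> M" for s
    using balanced_le[OF finD(3) _ bM zM _ that] supermodular_contraction_S_minus[OF fin sm st]
    by (simp add: M)
  have ge0: "y s \<ge> a" and le0: "y s \<le> a + 1" if "s \<in> D - C" for s
    using S_plus_bounds(1)[OF st, of s] S_minus_bounds(1)[OF st, of s] that sub y_eq[OF that]
    unfolding D_def C M by force+
  have "exchange y s t \<notin> mconvex_set S p" if st: "s \<in> S" "t \<in> S" "y t \<ge> y s + 2" for s t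
  proof
    assume e: "exchange y s t \<in> mconvex_set S p"
    then have cross: "t \<in> C \<Longrightarrow> s \<in> C" "t \<in> D \<Longrightarrow> s \<in> D"
      using exchange_mem_iff[OF fin y st(1,2)] tyCS tyD by simp_all
    consider "t \<in> C" | "t \<in> D - C" | "t \<in> M" using st(2) D_def by blast
    then show False
    proof cases
      case 1
      then have "tight S p (exchange y s t) C"
        using cross(1) tyCS finD(2) by (simp add: tight_def sum_exchange)
      then have "exchange y s t \<in> mconvex_set C p"
        using e mconvex_set_direct_sum[OF fin sm \<open>C \<subseteq> S\<close>, of "exchange y s t"] by simp
      then show False using bC 1 cross(1) st(3) by (simp add: balanced_def)
    next
      case 2
      then show False using cross(2) geC[of s] ge0[of s] le0[of t] st(3) by (cases "s \<in> C") auto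
    next
      case 3
      have "y s < a" using leM[OF 3] st(3) by simp
      then have "s \<notin> D" using geC[of s] ge0[of s] by (cases "s \<in> C") auto
      then have "s \<in> M" using st(1) D_def by simp
      have "t \<notin> D" using 3 D_def by simp
      then have "tight S p (exchange y s t) D"
        using \<open>s \<notin> D\<close> tyD finD(1) by (simp add: tight_def sum_exchange)
      then have "exchange y s t \<in> mconvex_set M (contraction S p M)"
        using e sumS[of "exchange y s t"] by simp
      then show False using bM 3 \<open>s \<in> M\<close> st(3) by (simp add: balanced_def)
    qed
  qed
  then show ?thesis using y by (simp add: balanced_def)
qed

lemma decomposition_output_balanced:
  assumes "decomposition_output step2_condition S p z" "finite S" "supermodular S p"
  shows "balanced S p z"
  using assms
proof (induction rule: decomposition_output.induct)
  case (1 p S v a z Sp Sm z')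
  have empty: "balanced {} f y" if "supermodular A f" for A f y
    using that by (simp add: balanced_def mconvex_set_iff supermodular_def)
  have fin: "finite Sp" "finite Sm"
    using 1(4,5) \<open>finite S\<close> S_plus_subset[of S p a z] S_minus_subset[of S p a z]
    by (auto intro: finite_subset)
  have sm: "supermodular Sp p" "supermodular Sm (contraction S p Sm)"
    using supermodular_S_plus[OF \<open>finite S\<close> \<open>supermodular S p\<close> 1(3)]
      supermodular_contraction_S_minus[OF \<open>finite S\<close> \<open>supermodular S p\<close> 1(3)] 1(4,5) by simp_all
  have "balanced Sp p z'"
    using 1(7) fin(1) sm(1) empty[OF sm(1)] by (cases "Sp = {}") simp_all
  moreover have "balanced Sm (contraction S p Sm) z'"
    using 1(8) fin(2) sm(2) empty[OF sm(2)] by (cases "Sm = {}") simp_all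
  ultimately show ?case
    by (rule balanced_composition[OF \<open>finite S\<close> \<open>supermodular S p\<close> 1(3,4,5,6)])
qed

lemma decomposition_output_mono:
  assumes "decomposition_output step2 S p z" "\<And>S p a z. step2 S p a z \<Longrightarrow> step2' S p a z"
  shows "decomposition_output step2' S p z"
  using assms(1)
proof (induction rule: decomposition_output.induct)
  case (1 p S v a z Sp Sm z')
  show ?case
  proof (rule decomposition_output.intros[where S = S and p = p and v = v and a = a and z = z])
    show "step2' S p a z" by (rule assms(2)[OF 1(3)])
  qed (use 1 in blast)+
qed

lemma decomposition_output_cong:
  assumes "decomposition_output step2 S p z" "\<forall>s\<in>S. z s = z' s"
  shows "decomposition_output step2 S p z'"
  using assms
proof (induction arbitrary: rule: decomposition_output.induct)
  case (1 p S v a z Sp Sm y)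
  have "\<forall>s\<in>S - (Sp \<union> Sm). z' s = z s" using 1(6,9) by simp
  moreover have "\<forall>s\<in>Sp. y s = z' s" "\<forall>s\<in>Sm. y s = z' s"
    using 1(4,5,9) S_plus_subset[of S p a z] S_minus_subset[of S p a z] by (simp_all add: subset_iff)
  ultimately show ?case
    using 1 by (intro decomposition_output.intros[where S = S and p = p and v = v and a = a and z = z]) blast+
qed

section \<open>Running programs\<close>

locale computation =
  fixes answer :: "'s set \<Rightarrow> int option"
    and sfm :: "'s set \<Rightarrow> ('s set \<Rightarrow> int option) \<Rightarrow> 's set"
    and q :: "nat poly"
  assumes sfm: "minimizes_submodular sfm"
begin

definition halts_within :: "(int, 's, 'r) prog \<Rightarrow> nat \<Rightarrow> ('r \<Rightarrow> bool) \<Rightarrow> bool" where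
  "halts_within c K R \<longleftrightarrow> (\<exists>r k. exec answer sfm q c = Some (r, k) \<and> k \<le> K \<and> R r)"

lemma exec_bind:
  "exec answer sfm q (c \<bind> g) =
     (case exec answer sfm q c of None \<Rightarrow> None
      | Some (r, k) \<Rightarrow> map_option (\<lambda>(r', k'). (r', k + k')) (exec answer sfm q (g r)))"
  by (induction c)
    (auto simp: option.map_comp comp_def split_def ac_simps option.map_ident option.map_id
      split: option.splits)

lemma halts_Ret [intro]: "R r \<Longrightarrow> halts_within (Ret r) K R"
  by (simp add: halts_within_def)

text \<open>
  The bound acts as a budget from which each step takes its share, so that in a chain of steps the
  bound of the remaining program need not be guessed.
\<close>

lemma halts_bind:
  assumes "halts_within c K1 R" "K1 \<le> K" "\<And>r. R r \<Longrightarrow> halts_within (g r) (K - K1) Q"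
  shows "halts_within (c \<bind> g) K Q"
proof -
  obtain r k where r: "exec answer sfm q c = Some (r, k)" "k \<le> K1" "R r"
    using assms(1) unfolding halts_within_def by (elim exE conjE)
  obtain r' k' where "exec answer sfm q (g r) = Some (r', k')" "k' \<le> K - K1" "Q r'"
    using assms(3)[OF r(3)] unfolding halts_within_def by (elim exE conjE)
  then show ?thesis using r assms(2) by (simp add: halts_within_def exec_bind)
qed

lemma halts_mono:
  assumes "halts_within c K R" "K \<le> K'" "\<And>r. R r \<Longrightarrow> Q r"
  shows "halts_within c K' Q"
  using assms(1,3) order_trans[OF _ assms(2)] unfolding halts_within_def by metis

lemma exec_compute:
  "exec answer sfm q (compute e) = map_option (\<lambda>v. (v, expr_cost e)) (expr_value answer e)"
  by (cases "expr_value answer e") (simp_all add: compute_def)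

lemma halts_compute:
  assumes "expr_value answer e = Some v" "expr_cost e \<le> K"
  shows "halts_within (compute e) K (\<lambda>r. r = v)"
  using assms by (simp add: halts_within_def exec_compute)

lemma halts_leq: "halts_within (leq x y) 1 (\<lambda>b. b \<longleftrightarrow> x \<le> y)"
  by (simp add: halts_within_def leq_def)

lemma poly_nat_mono: "m \<le> n \<Longrightarrow> poly (r :: nat poly) m \<le> poly r n"
  by (induction r) (auto intro: mult_le_mono)

lemma halts_minimizer:
  assumes "finite T" "submodular T (\<lambda>X. expr_value answer (f X))"
    "W \<subseteq> T" "expr_value answer (f W) \<noteq> None"
    "\<And>X. X \<subseteq> T \<Longrightarrow> expr_cost (f X) \<le> c" "card T \<le> N"
  shows "halts_within (minimizer T f) (poly q N * (1 + c))
    (\<lambda>U. U \<subseteq> T \<and> (\<exists>m. expr_value answer (f U) = Some m \<and>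
       (\<forall>X v. X \<subseteq> T \<longrightarrow> expr_value answer (f X) = Some v \<longrightarrow> m \<le> v)))"
proof -
  have "Max ((\<lambda>X. expr_cost (f X)) ` Pow T) \<le> c" using assms(1,5) by (subst Max_le_iff) auto
  then have "poly q (card T) * (1 + Max ((\<lambda>X. expr_cost (f X)) ` Pow T)) \<le> poly q N * (1 + c)"
    using poly_nat_mono[OF assms(6)] by (intro mult_le_mono) simp_all
  moreover have "sfm T (\<lambda>X. expr_value answer (f X)) \<subseteq> T \<and>
      (\<exists>m. expr_value answer (f (sfm T (\<lambda>X. expr_value answer (f X)))) = Some m \<and>
       (\<forall>X v. X \<subseteq> T \<longrightarrow> expr_value answer (f X) = Some v \<longrightarrow> m \<le> v))"
    using sfm[unfolded minimizes_submodular_def, rule_format, OF assms(1,2)] assms(3,4)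
    by metis
  ultimately show ?thesis by (simp add: halts_within_def minimizer_def)
qed

lemma halts_filter_prog:
  assumes "\<And>e. e \<in> set es \<Longrightarrow> halts_within (c e) K (\<lambda>b. b \<longleftrightarrow> P e)"
  shows "halts_within (filter_prog c es) (length es * K) (\<lambda>r. r = filter P es)"
  using assms
proof (induction es)
  case (Cons e es)
  have "halts_within (c e) K (\<lambda>b. b \<longleftrightarrow> P e)" using Cons.prems by simp
  then have "halts_within (c e \<bind> (\<lambda>b. filter_prog c es \<bind> (\<lambda>fs. Ret (if b then e # fs else fs))))
      (length (e # es) * K) (\<lambda>r. r = filter P (e # es))"
  proof (rule halts_bind)
    fix b assume b: "b \<longleftrightarrow> P e"
    have "halts_within (filter_prog c es) (length es * K) (\<lambda>r. r = filter P es)"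
      using Cons by simp
    then show "halts_within (filter_prog c es \<bind> (\<lambda>fs. Ret (if b then e # fs else fs)))
        (length (e # es) * K - K) (\<lambda>r. r = filter P (e # es))"
      by (rule halts_bind) (auto simp: b)
  qed simp
  then show ?case by simp
qed auto

lemma halts_exists_prog:
  assumes "\<And>e. e \<in> set es \<Longrightarrow> halts_within (c e) K (\<lambda>b. b \<longleftrightarrow> P e)"
  shows "halts_within (exists_prog c es) (length es * K) (\<lambda>b. b \<longleftrightarrow> (\<exists>e\<in>set es. P e))"
  using assms
proof (induction es)
  case (Cons e es)
  have "halts_within (c e) K (\<lambda>b. b \<longleftrightarrow> P e)" using Cons.prems by simp
  then have "halts_within (c e \<bind> (\<lambda>b. if b then Ret True else exists_prog c es))
      (length (e # es) * K) (\<lambda>b. b \<longleftrightarrow> (\<exists>e\<in>set (e # es). P e))"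
  proof (rule halts_bind)
    fix b assume b: "b \<longleftrightarrow> P e"
    have "halts_within (exists_prog c es) (length es * K) (\<lambda>b. b \<longleftrightarrow> (\<exists>e\<in>set es. P e))"
      using Cons by simp
    then show "halts_within (if b then Ret True else exists_prog c es)
        (length (e # es) * K - K) (\<lambda>b. b \<longleftrightarrow> (\<exists>e\<in>set (e # es). P e))"
      using b by (auto elim: halts_mono)
  qed simp
  then show ?case by simp
qed auto

lemma halts_vector_prog:
  assumes "\<And>e. e \<in> set es \<Longrightarrow> expr_value answer (f e) = Some (g e)"
    "\<And>e. e \<in> set es \<Longrightarrow> expr_cost (f e) \<le> K"
  shows "halts_within (vector_prog f es x) (length es * K) (\<lambda>r. \<forall>e\<in>set es. r e = g e)"
proof -
  have "halts_within (vector_prog f es x) (length es * K)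
      (\<lambda>r. \<forall>e. r e = (if e \<in> set es then g e else x e))"
    using assms
  proof (induction es arbitrary: x)
    case (Cons e es)
    have "halts_within (compute (f e)) K (\<lambda>v. v = g e)" using Cons.prems by (simp add: halts_compute)
    then have "halts_within (compute (f e) \<bind> (\<lambda>v. vector_prog f es (x(e := v))))
        (length (e # es) * K) (\<lambda>r. \<forall>d. r d = (if d \<in> set (e # es) then g d else x d))"
    proof (rule halts_bind)
      fix v assume v: "v = g e"
      have "halts_within (vector_prog f es (x(e := v))) (length es * K)
          (\<lambda>r. \<forall>d. r d = (if d \<in> set es then g d else (x(e := v)) d))"
        using Cons by simp
      then show "halts_within (vector_prog f es (x(e := v))) (length (e # es) * K - K)
          (\<lambda>r. \<forall>d. r d = (if d \<in> set (e # es) then g d else x d))"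
        by (rule halts_mono) (auto simp: v)
    qed simp
    then show ?case by simp
  qed auto
  then show ?thesis by (rule halts_mono) auto
qed

lemma expr_value_sum_expr:
  assumes "\<And>e. e \<in> set es \<Longrightarrow> expr_value answer (f e) = Some (g e)"
  shows "expr_value answer (sum_expr f es) = Some (\<Sum>e\<leftarrow>es. g e)"
  using assms by (induction es) (simp_all add: sum_expr_def)

lemma expr_value_sum_expr_filter:
  assumes "distinct xs" "X \<subseteq> set xs" "\<And>e. expr_value answer (f e) = Some (g e)"
  shows "expr_value answer (sum_expr f (filter (\<lambda>e. e \<in> X) xs)) = Some (sum g X)"
proof -
  have "set (filter (\<lambda>e. e \<in> X) xs) = X" using assms(2) by auto
  then show ?thesis
    using assms(1,3) expr_value_sum_expr[of "filter (\<lambda>e. e \<in> X) xs" f g]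
    by (simp add: sum_list_distinct_conv_sum_set)
qed

end

lemma expr_cost_sum_expr:
  assumes "\<And>e. expr_cost (f e) = 0"
  shows "expr_cost (sum_expr f es) = length es"
  using assms by (induction es) (simp_all add: sum_expr_def)

section \<open>The greedy algorithm\<close>

text \<open>
  The supermodular function is represented by the relation \<open>G Y w\<close> that \<open>w\<close> is one of the lower
  bounds for the component sum over \<open>Y\<close>; its value at \<open>Y\<close> is the greatest one. No bound at all stands
  for minus infinity.
\<close>

definition supermodular_bounds :: "('e set \<Rightarrow> int \<Rightarrow> bool) \<Rightarrow> bool" where
  "supermodular_bounds G \<longleftrightarrow>
     (\<forall>Y Y' w w'. G Y w \<longrightarrow> G Y' w' \<longrightarrow> (\<exists>k l. G (Y \<inter> Y') k \<and> G (Y \<union> Y') l \<and> w + w' \<le> k + l))"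

definition greatest_bound :: "('e set \<Rightarrow> int \<Rightarrow> bool) \<Rightarrow> 'e set \<Rightarrow> int \<Rightarrow> bool" where
  "greatest_bound G Y w \<longleftrightarrow> G Y w \<and> (\<forall>w'. G Y w' \<longrightarrow> w' \<le> w)"

text \<open>
  One greedy step keeps all lower bounds: for \<open>e \<in> Z\<close>, supermodularity for \<open>Z\<close> and \<open>Y\<close> bounds the
  value at \<open>Z\<close> by the value at \<open>Z - {e}\<close> plus the increment at \<open>e\<close>.
\<close>

lemma greedy_step:
  fixes x :: "'e \<Rightarrow> int"
  assumes "supermodular_bounds G" "finite Y" "e \<notin> Y" "G Y w" "greatest_bound G (insert e Y) v"
    and lower: "\<And>Z u. Z \<subseteq> Y \<Longrightarrow> G Z u \<Longrightarrow> u \<le> sum x Z"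
    and Z: "Z \<subseteq> insert e Y" "G Z u"
  shows "u \<le> sum (x(e := v - w)) Z"
proof (cases "e \<in> Z")
  case False
  then have "sum (x(e := v - w)) Z = sum x Z" by (intro sum.cong) auto
  moreover have "Z \<subseteq> Y" using False Z(1) by blast
  ultimately show ?thesis using lower[OF _ Z(2)] by simp
next
  case True
  obtain k l where kl: "G (Z \<inter> Y) k" "G (Z \<union> Y) l" "u + w \<le> k + l"
    using assms(1)[unfolded supermodular_bounds_def, rule_format, OF Z(2) assms(4)]
    by (elim exE conjE)
  have "Z \<union> Y = insert e Y" using True Z(1) by blast
  then have "l \<le> v" using kl(2) assms(5) by (simp add: greatest_bound_def)
  moreover have "k \<le> sum x (Z \<inter> Y)" by (rule lower[OF _ kl(1)]) simp
  moreover have "sum (x(e := v - w)) Z = v - w + sum x (Z \<inter> Y)"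
  proof -
    have "Z = insert e (Z \<inter> Y)" using True Z(1) by blast
    then have "sum (x(e := v - w)) Z = sum (x(e := v - w)) (insert e (Z \<inter> Y))" by simp
    also have "\<dots> = v - w + sum (x(e := v - w)) (Z \<inter> Y)"
      using assms(2,3) by (subst sum.insert) simp_all
    also have "sum (x(e := v - w)) (Z \<inter> Y) = sum x (Z \<inter> Y)"
      using assms(3) by (intro sum.cong) auto
    finally show ?thesis .
  qed
  ultimately show ?thesis using kl(3) by linarith
qed

context computation
begin

text \<open>
  Only the values of the set-function at prefixes of the order are computed, and only these are
  required to be finite. The component sums of the greedy vector over prefixes equal these values.
\<close>

lemma halts_greedy:
  fixes G :: "'e set \<Rightarrow> int \<Rightarrow> bool"
  assumes "supermodular_bounds G"
    and "\<And>ys e zs. es = ys @ e # zs \<Longrightarrow>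
      halts_within (P (insert e (Y \<union> set ys))) K (greatest_bound G (insert e (Y \<union> set ys)))"
    and "distinct es" "set es \<inter> Y = {}" "finite Y" "greatest_bound G Y w" "sum x Y = w"
    and "\<And>Z u. Z \<subseteq> Y \<Longrightarrow> G Z u \<Longrightarrow> u \<le> sum x Z"
  shows "halts_within (greedy P Y w es x) (length es * (K + 1))
    (\<lambda>r. (\<forall>Z u. Z \<subseteq> Y \<union> set es \<longrightarrow> G Z u \<longrightarrow> u \<le> sum r Z) \<and>
         (\<forall>ys zs. es = ys @ zs \<longrightarrow> greatest_bound G (Y \<union> set ys) (sum r (Y \<union> set ys))) \<and>
         (\<forall>e. e \<notin> set es \<longrightarrow> r e = x e))"
  using assms(2-)
proof (induction es arbitrary: Y w x)
  case Nil
  then show ?case by (auto intro!: halts_Ret)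
next
  case (Cons e es)
  let ?post = "\<lambda>r. (\<forall>Z u. Z \<subseteq> Y \<union> set (e # es) \<longrightarrow> G Z u \<longrightarrow> u \<le> sum r Z) \<and>
         (\<forall>ys zs. e # es = ys @ zs \<longrightarrow> greatest_bound G (Y \<union> set ys) (sum r (Y \<union> set ys))) \<and>
         (\<forall>d. d \<notin> set (e # es) \<longrightarrow> r d = x d)"
  have e: "e \<notin> Y" "e \<notin> set es" using Cons.prems(2,3) by simp_all
  have "halts_within (P (insert e Y)) K (greatest_bound G (insert e Y))"
    using Cons.prems(1)[of "[]" e es] by simp
  then have "halts_within (P (insert e Y) \<bind> (\<lambda>v. compute (Minus (Val v) (Val w)) \<bind>
        (\<lambda>d. greedy P (insert e Y) v es (x(e := d))))) (length (e # es) * (K + 1)) ?post"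
  proof (rule halts_bind)
    fix v assume v: "greatest_bound G (insert e Y) v"
    let ?x = "x(e := v - w)"
    have "halts_within (greedy P (insert e Y) v es ?x) (length es * (K + 1))
      (\<lambda>r. (\<forall>Z u. Z \<subseteq> insert e Y \<union> set es \<longrightarrow> G Z u \<longrightarrow> u \<le> sum r Z) \<and>
         (\<forall>ys zs. es = ys @ zs \<longrightarrow>
            greatest_bound G (insert e Y \<union> set ys) (sum r (insert e Y \<union> set ys))) \<and>
         (\<forall>d. d \<notin> set es \<longrightarrow> r d = ?x d))"
    proof (rule Cons.IH)
      show "halts_within (P (insert d (insert e Y \<union> set ys))) K
          (greatest_bound G (insert d (insert e Y \<union> set ys)))" if "es = ys @ d # zs" for ys d zs
        using Cons.prems(1)[of "e # ys" d zs] that by simp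
      have "sum ?x Y = sum x Y" using e(1) by (intro sum.cong) auto
      then show "sum ?x (insert e Y) = v" using Cons.prems(4,6) e(1) by simp
      show "u \<le> sum ?x Z" if "Z \<subseteq> insert e Y" "G Z u" for Z u
        using Cons.prems(4,5) that
        by (intro greedy_step[OF assms(1) _ e(1) _ v Cons.prems(7)]) (simp_all add: greatest_bound_def)
    qed (use Cons.prems e v in auto)
    then have rec: "halts_within (greedy P (insert e Y) v es ?x) (length es * (K + 1)) ?post"
    proof (rule halts_mono, goal_cases)
      case (2 r)
      then have r: "\<And>Z u. Z \<subseteq> insert e Y \<union> set es \<Longrightarrow> G Z u \<Longrightarrow> u \<le> sum r Z"
        "\<And>ys zs. es = ys @ zs \<Longrightarrow>
            greatest_bound G (insert e Y \<union> set ys) (sum r (insert e Y \<union> set ys))"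
        "\<And>d. d \<notin> set es \<Longrightarrow> r d = ?x d"
        by simp_all
      have "greatest_bound G (Y \<union> set ys) (sum r (Y \<union> set ys))" if "e # es = ys @ zs" for ys zs
      proof (cases ys)
        case Nil
        have "r d = x d" if "d \<in> Y" for d
        proof -
          have "d \<notin> set es" "d \<noteq> e" using that e(1) Cons.prems(3) by auto
          then show ?thesis using r(3)[of d] by simp
        qed
        then have "sum r Y = sum x Y" by (intro sum.cong) simp_all
        then show ?thesis using Nil Cons.prems(5,6) by simp
      next
        case (Cons d ys')
        then show ?thesis using that r(2)[of ys' zs] by simp
      qed
      then show ?case using r(1,3) by simp
    qed simp
    have "halts_within (compute (Minus (Val v) (Val w))) 1 (\<lambda>d. d = v - w)"
      by (rule halts_compute) simp_all
    then show "halts_within (compute (Minus (Val v) (Val w)) \<bind>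
        (\<lambda>d. greedy P (insert e Y) v es (x(e := d)))) (length (e # es) * (K + 1) - K) ?post"
    proof (rule halts_bind)
      fix d assume "d = v - w"
      then show "halts_within (greedy P (insert e Y) v es (x(e := d)))
          (length (e # es) * (K + 1) - K - 1) ?post"
        using rec by simp
    qed simp
  qed simp
  then show ?case by simp
qed

end

section \<open>The second step\<close>

text \<open>
  For integers, \<open>max (a - y) 0 + max (y - a - 1) 0\<close> is the distance of \<open>y\<close> from \<open>{a, a + 1}\<close>.
  The least objective value of a splitting of a vector is the sum of these distances. An exchange
  of the kind that is to be excluded brings one component nearer to \<open>{a, a + 1}\<close> and leaves the other
  at most as far, so that it would decrease the minimum.
\<close>

lemma step2_condition_if_linear_minimizer:
  assumes "finite S"
    and min: "is_arg_min (\<lambda>(x1, x2, x3). (\<Sum>s\<in>S. a - x1 s) + (\<Sum>s\<in>S. x3 s))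
      (\<lambda>x. x \<in> split_vectors S p a) (x1, x2, x3)"
    and z: "\<forall>s\<in>S. z s = x1 s + x2 s + x3 s"
  shows "step2_condition S p a z"
proof -
  let ?h = "\<lambda>y :: int. max (a - y) 0 + max (y - a - 1) 0"
  have x: "(x1, x2, x3) \<in> split_vectors S p a" using min by (simp add: is_arg_min_def)
  then have box: "\<forall>s\<in>S. x1 s \<le> a \<and> 0 \<le> x2 s \<and> x2 s \<le> 1 \<and> 0 \<le> x3 s"
    and "(\<lambda>s. x1 s + x2 s + x3 s) \<in> mconvex_set S p" by (simp_all add: split_vectors_def)
  then have z_mem: "z \<in> mconvex_set S p" using mconvex_set_cong[OF z] by simp
  have least: "(\<Sum>s\<in>S. ?h (z s)) \<le> (\<Sum>s\<in>S. ?h (y s))" if y: "y \<in> mconvex_set S p" for y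
  proof -
    let ?y1 = "\<lambda>s. min (y s) a" and ?y2 = "\<lambda>s. of_bool (y s > a) :: int"
      and ?y3 = "\<lambda>s. max (y s - a - 1) 0"
    have "(\<lambda>s. ?y1 s + ?y2 s + ?y3 s) = y" by (auto simp: fun_eq_iff)
    then have "(?y1, ?y2, ?y3) \<in> split_vectors S p a" using y by (simp add: split_vectors_def)
    then have le: "(\<Sum>s\<in>S. a - x1 s) + (\<Sum>s\<in>S. x3 s) \<le> (\<Sum>s\<in>S. a - ?y1 s) + (\<Sum>s\<in>S. ?y3 s)"
      using min by (auto simp: is_arg_min_linorder)
    have "(\<Sum>s\<in>S. ?h (z s)) \<le> (\<Sum>s\<in>S. (a - x1 s) + x3 s)"
    proof (rule sum_mono)
      fix s assume s: "s \<in> S"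
      have "z s = x1 s + x2 s + x3 s" "x1 s \<le> a" "0 \<le> x2 s" "x2 s \<le> 1" "0 \<le> x3 s"
        using box z s by simp_all
      then show "?h (z s) \<le> (a - x1 s) + x3 s" by linarith
    qed
    also have "\<dots> \<le> (\<Sum>s\<in>S. (a - ?y1 s) + ?y3 s)" using le by (simp only: sum.distrib)
    also have "\<dots> = (\<Sum>s\<in>S. ?h (y s))" by (intro sum.cong) auto
    finally show ?thesis .
  qed
  have "exchange z s t \<notin> mconvex_set S p"
    if st: "s \<in> S" "t \<in> S" "z s \<le> a" "z t \<ge> a + 1" "z t \<ge> z s + 2" for s t
  proof
    assume "exchange z s t \<in> mconvex_set S p"
    then have le: "(\<Sum>r\<in>S. ?h (z r)) \<le> (\<Sum>r\<in>S. ?h (exchange z s t r))" by (rule least)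
    have "s \<noteq> t" using st by auto
    then have ex: "exchange z s t s = z s + 1" "exchange z s t t = z t - 1"
      "\<And>r. r \<noteq> s \<Longrightarrow> r \<noteq> t \<Longrightarrow> exchange z s t r = z r" by (simp_all add: exchange_def)
    have s_le: "?h (exchange z s t s) \<le> ?h (z s)" and t_le: "?h (exchange z s t t) \<le> ?h (z t)"
      using st(3,4) unfolding ex by linarith+
    have "?h (exchange z s t r) \<le> ?h (z r)" for r
      using s_le t_le ex(3)[of r] by (cases "r = s"; cases "r = t") simp_all
    moreover have "?h (exchange z s t s) < ?h (z s) \<or> ?h (exchange z s t t) < ?h (z t)"
      using st(3-5) unfolding ex by linarith
    then have "\<exists>r\<in>S. ?h (exchange z s t r) < ?h (z r)"
      using st(1,2) by (elim disjE) (rule bexI, assumption+)+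
    ultimately have "(\<Sum>r\<in>S. ?h (exchange z s t r)) < (\<Sum>r\<in>S. ?h (z r))"
      using assms(1) by (intro sum_strict_mono_ex1) simp_all
    with le show False by linarith
  qed
  then show ?thesis using z_mem by (simp add: step2_condition_def)
qed

text \<open>
  The greatest bound at \<open>Y\<close> is \<open>max {p(X) - a |X - Y\<^sub>1| - |X - Y\<^sub>2| : Y\<^sub>1 \<subseteq> X \<subseteq> Y\<^sub>3}\<close>. As a function
  of \<open>Y\<close> this is the supermodular function whose base-polyhedron has the splittings as its integral
  points: the component sum over \<open>Y\<close> of a splitting of \<open>x\<close> is at least \<open>x(X)\<close> minus the largest
  possible contribution of the components of \<open>X\<close> that are missing in \<open>Y\<close>.
\<close>

definition split_bound ::
  "'s set \<Rightarrow> ('s set \<Rightarrow> int option) \<Rightarrow> int \<Rightarrow> (copy \<times> 's) set \<Rightarrow> int \<Rightarrow> bool" where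
  "split_bound S p a Y w \<longleftrightarrow>
     (\<exists>X u. copy_part Low Y \<subseteq> X \<and> X \<subseteq> copy_part High Y \<and> X \<subseteq> S \<and> p X = Some u \<and>
        w = u - a * int (card (X - copy_part Low Y)) - int (card (X - copy_part Mid Y)))"

lemma copy_part_simps:
  "copy_part i (Y \<inter> Y') = copy_part i Y \<inter> copy_part i Y'"
  "copy_part i (Y \<union> Y') = copy_part i Y \<union> copy_part i Y'"
  "copy_part i (Y - Y') = copy_part i Y - copy_part i Y'"
  "copy_part i (I \<times> X) = (if i \<in> I then X else {})"
  "copy_part i {} = {}"
  "copy_part i (insert (j, s) Y) = (if i = j then insert s (copy_part i Y) else copy_part i Y)"
  by (auto simp: copy_part_def)

lemma card_Diff_submodular:
  assumes "finite A" "finite A'"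
  shows "card (A \<inter> A' - B \<inter> B') + card (A \<union> A' - (B \<union> B')) \<le> card (A - B) + card (A' - B')"
proof -
  let ?L = "A \<inter> A' - B \<inter> B'" and ?M = "A \<union> A' - (B \<union> B')"
  have "card ?L + card ?M = card (?L \<union> ?M) + card (?L \<inter> ?M)"
    using assms by (intro card_Un_Int) auto
  also have "\<dots> \<le> card ((A - B) \<union> (A' - B')) + card ((A - B) \<inter> (A' - B'))"
    using assms by (intro add_mono card_mono) auto
  also have "\<dots> = card (A - B) + card (A' - B')"
    using assms by (intro card_Un_Int[symmetric]) auto
  finally show ?thesis .
qed

lemma card_Diff_modular:
  assumes "finite A" "finite A'" "B \<subseteq> A" "B' \<subseteq> A'"
  shows "card (A \<inter> A' - B \<inter> B') + card (A \<union> A' - (B \<union> B')) = card (A - B) + card (A' - B')"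
proof -
  have fin: "finite B" "finite B'" using assms by (auto intro: finite_subset)
  have "card (A \<inter> A' - B \<inter> B') = card (A \<inter> A') - card (B \<inter> B')"
    "card (A \<union> A' - (B \<union> B')) = card (A \<union> A') - card (B \<union> B')"
    "card (A - B) = card A - card B" "card (A' - B') = card A' - card B'"
    using assms fin by (auto intro!: card_Diff_subset)
  moreover have "card A + card A' = card (A \<union> A') + card (A \<inter> A')"
    "card B + card B' = card (B \<union> B') + card (B \<inter> B')"
    using assms fin by (auto intro!: card_Un_Int)
  moreover have "card (B \<inter> B') \<le> card (A \<inter> A')" "card (B \<union> B') \<le> card (A \<union> A')"
    "card B \<le> card A" "card B' \<le> card A'"
    using assms by (auto intro!: card_mono)
  ultimately show ?thesis by linarith
qed

lemma supermodular_split_bound: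
  assumes "finite S" "supermodular S p"
  shows "supermodular_bounds (split_bound S p a)"
  unfolding supermodular_bounds_def
proof (intro allI impI)
  fix Y Y' w w' assume "split_bound S p a Y w" "split_bound S p a Y' w'"
  then obtain X u X' u' where
    X: "copy_part Low Y \<subseteq> X" "X \<subseteq> copy_part High Y" "X \<subseteq> S" "p X = Some u"
      "w = u - a * int (card (X - copy_part Low Y)) - int (card (X - copy_part Mid Y))" and
    X': "copy_part Low Y' \<subseteq> X'" "X' \<subseteq> copy_part High Y'" "X' \<subseteq> S" "p X' = Some u'"
      "w' = u' - a * int (card (X' - copy_part Low Y')) - int (card (X' - copy_part Mid Y'))"
    unfolding split_bound_def by (elim exE conjE)
  obtain k l where kl: "p (X \<inter> X') = Some k" "p (X \<union> X') = Some l" "u + u' \<le> k + l"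
    using supermodularD[OF assms(2) X(3) X'(3) X(4) X'(4)] by (elim exE conjE)
  have fin: "finite X" "finite X'" using assms(1) X(3) X'(3) by (auto intro: finite_subset)
  let ?low = "\<lambda>X Y. a * int (card (X - copy_part Low Y))"
    and ?mid = "\<lambda>X Y. int (card (X - copy_part Mid Y))"
  have "split_bound S p a (Y \<inter> Y') (k - ?low (X \<inter> X') (Y \<inter> Y') - ?mid (X \<inter> X') (Y \<inter> Y'))"
    unfolding split_bound_def using X X' kl(1)
    by (intro exI[of _ "X \<inter> X'"] exI[of _ k]) (auto simp: copy_part_simps)
  moreover have "split_bound S p a (Y \<union> Y') (l - ?low (X \<union> X') (Y \<union> Y') - ?mid (X \<union> X') (Y \<union> Y'))"
    unfolding split_bound_def using X X' kl(2)
    by (intro exI[of _ "X \<union> X'"] exI[of _ l]) (auto simp: copy_part_simps)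
  moreover have "?low (X \<inter> X') (Y \<inter> Y') + ?low (X \<union> X') (Y \<union> Y') = ?low X Y + ?low X' Y'"
    using card_Diff_modular[OF fin X(1) X'(1)]
    by (simp add: copy_part_simps flip: distrib_left of_nat_add)
  moreover have "?mid (X \<inter> X') (Y \<inter> Y') + ?mid (X \<union> X') (Y \<union> Y') \<le> ?mid X Y + ?mid X' Y'"
    using card_Diff_submodular[OF fin, of "copy_part Mid Y" "copy_part Mid Y'"]
    by (simp add: copy_part_simps flip: of_nat_add)
  ultimately show "\<exists>k l. split_bound S p a (Y \<inter> Y') k \<and> split_bound S p a (Y \<union> Y') l \<and> w + w' \<le> k + l"
    using kl(3) X(5) X'(5) by (intro exI conjI) (assumption, assumption, linarith)
qed

lemma sum_copies:
  "sum r (I \<times> X) = (\<Sum>i\<in>I. \<Sum>s\<in>X. r (i, s))"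
  by (simp add: sum.cartesian_product)

lemma UNIV_copy: "(UNIV :: copy set) = {Low, Mid, High}"
  using copy.exhaust by auto

text \<open>
  The linear objective equals \<open>a |S| - p(S)\<close> plus the component sums over \<open>High\<close> and over
  \<open>High\<close> and \<open>Mid\<close> together; the greedy vector attains the lower bounds for both. The lower box
  constraints are lower bounds for singletons, the upper ones are lower bounds for complements of
  singletons, since the total is fixed.
\<close>

lemma greedy_splitting_optimal:
  assumes fin: "finite S" and sm: "supermodular S p"
    and lower: "\<And>Z u. Z \<subseteq> UNIV \<times> S \<Longrightarrow> split_bound S p a Z u \<Longrightarrow> u \<le> sum r Z"
    and high: "greatest_bound (split_bound S p a) ({High} \<times> S) (sum r ({High} \<times> S))"
    and mid: "greatest_bound (split_bound S p a) ({High, Mid} \<times> S) (sum r ({High, Mid} \<times> S))"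
    and all: "greatest_bound (split_bound S p a) (UNIV \<times> S) (sum r (UNIV \<times> S))"
    and z: "\<forall>s\<in>S. z s = r (Low, s) + r (Mid, s) + r (High, s)"
  shows "step2_by_linear_minimization S p a z"
proof -
  let ?r = "\<lambda>i s. r (i, s)"
  obtain v where pS: "p S = Some v" using sm by (auto simp: supermodular_def)
  have p0: "p {} = Some 0" using sm by (simp add: supermodular_def)
  have finE: "finite ((UNIV :: copy set) \<times> S)" using fin by (simp add: UNIV_copy)
  have total: "sum r (UNIV \<times> S) = v"
  proof -
    obtain X u where "S \<subseteq> X" "X \<subseteq> S" "p X = Some u"
      "sum r (UNIV \<times> S) = u - a * int (card (X - S)) - int (card (X - S))"
      using all unfolding greatest_bound_def split_bound_def by (auto simp: copy_part_simps)
    moreover from this have "X = S" by blast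
    ultimately show ?thesis using pS by simp
  qed
  have sum3: "sum r (UNIV \<times> X) = (\<Sum>s\<in>X. ?r Low s + ?r Mid s + ?r High s)" for X
    by (simp add: sum_copies UNIV_copy sum.distrib)
  have box: "?r Low s \<le> a \<and> 0 \<le> ?r Mid s \<and> ?r Mid s \<le> 1 \<and> 0 \<le> ?r High s" if s: "s \<in> S" for s
  proof -
    have compl: "sum r (UNIV \<times> S - {(i, s)}) = v - r (i, s)" for i
      using total finE s by (simp add: sum_diff1)
    \<comment> \<open>Taking \<open>X = S\<close> in the bound costs \<open>a\<close> if \<open>(Low, s)\<close> is missing, and \<open>1\<close> if \<open>(Mid, s)\<close> is.\<close>
    have "S - (S - {s}) = {s}" using s by blast
    then have "split_bound S p a (UNIV \<times> S - {(Low, s)}) (v - a)"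
      unfolding split_bound_def using pS s
      by (intro exI[of _ S] exI[of _ v]) (auto simp: copy_part_simps)
    then have "v - a \<le> sum r (UNIV \<times> S - {(Low, s)})" by (rule lower[rotated]) blast
    moreover have "split_bound S p a (UNIV \<times> S - {(Mid, s)}) (v - 1)"
      unfolding split_bound_def using pS s \<open>S - (S - {s}) = {s}\<close>
      by (intro exI[of _ S] exI[of _ v]) (auto simp: copy_part_simps)
    then have "v - 1 \<le> sum r (UNIV \<times> S - {(Mid, s)})" by (rule lower[rotated]) blast
    moreover have "split_bound S p a {(i, s)} 0" if "i \<noteq> Low" for i
      unfolding split_bound_def using p0 that
      by (intro exI[of _ "{}"] exI[of _ 0]) (auto simp: copy_part_simps)
    then have "0 \<le> sum r {(i, s)}" if "i \<noteq> Low" for i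
      using that s by (intro lower) simp_all
    from this[of Mid] this[of High] have "0 \<le> ?r Mid s" "0 \<le> ?r High s" by simp_all
    ultimately show ?thesis by (simp add: compl)
  qed
  have "v' \<le> (\<Sum>s\<in>X. ?r Low s + ?r Mid s + ?r High s)" if "X \<subseteq> S" "p X = Some v'" for X v'
  proof -
    have "split_bound S p a (UNIV \<times> X) v'"
      unfolding split_bound_def using that
      by (intro exI[of _ X] exI[of _ v']) (auto simp: copy_part_simps)
    then have "v' \<le> sum r (UNIV \<times> X)" using that(1) by (intro lower) auto
    then show ?thesis by (simp only: sum3)
  qed
  then have "(\<lambda>s. ?r Low s + ?r Mid s + ?r High s) \<in> mconvex_set S p"
    using total pS unfolding mconvex_set_iff by (simp add: sum3)
  then have split: "(?r Low, ?r Mid, ?r High) \<in> split_vectors S p a"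
    using box by (simp add: split_vectors_def)
  have "(\<Sum>s\<in>S. a - ?r Low s) + (\<Sum>s\<in>S. ?r High s) \<le> (\<Sum>s\<in>S. a - y1 s) + (\<Sum>s\<in>S. y3 s)"
    if y: "(y1, y2, y3) \<in> split_vectors S p a" for y1 y2 y3
  proof -
    have ybox: "y1 s \<le> a" "0 \<le> y2 s" "y2 s \<le> 1" "0 \<le> y3 s" if "s \<in> S" for s
      using y that by (simp_all add: split_vectors_def)
    have mem: "(\<lambda>s. y1 s + y2 s + y3 s) \<in> mconvex_set S p" using y by (simp add: split_vectors_def)
    have "sum r ({High} \<times> S) \<le> (\<Sum>s\<in>S. y3 s)"
    proof -
      obtain X u where X: "X \<subseteq> S" "p X = Some u"
        "sum r ({High} \<times> S) = u - a * int (card X) - int (card X)"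
        using high unfolding greatest_bound_def split_bound_def by (auto simp: copy_part_simps)
      have "u \<le> (\<Sum>s\<in>X. y1 s + y2 s + y3 s)" by (rule mconvex_set_lower_bound[OF mem X(1,2)])
      also have "\<dots> \<le> (\<Sum>s\<in>X. a + 1 + y3 s)"
      proof (rule sum_mono)
        fix s assume "s \<in> X"
        then show "y1 s + y2 s + y3 s \<le> a + 1 + y3 s" using ybox[of s] X(1) by force
      qed
      also have "\<dots> = a * int (card X) + int (card X) + (\<Sum>s\<in>X. y3 s)"
        by (simp add: sum.distrib algebra_simps)
      also have "(\<Sum>s\<in>X. y3 s) \<le> (\<Sum>s\<in>S. y3 s)" using X(1) fin ybox by (intro sum_mono2) auto
      finally show ?thesis using X(3) by simp
    qed
    moreover have "sum r ({High, Mid} \<times> S) \<le> (\<Sum>s\<in>S. y2 s + y3 s)"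
    proof -
      obtain X u where X: "X \<subseteq> S" "p X = Some u"
        "sum r ({High, Mid} \<times> S) = u - a * int (card X) - int (card (X - S))"
        using mid unfolding greatest_bound_def split_bound_def by (auto simp: copy_part_simps)
      have "card (X - S) = 0" using X(1) by (simp add: Diff_eq_empty_iff[THEN iffD2])
      have "u \<le> (\<Sum>s\<in>X. y1 s + y2 s + y3 s)" by (rule mconvex_set_lower_bound[OF mem X(1,2)])
      also have "\<dots> \<le> (\<Sum>s\<in>X. a + (y2 s + y3 s))"
      proof (rule sum_mono)
        fix s assume "s \<in> X"
        then show "y1 s + y2 s + y3 s \<le> a + (y2 s + y3 s)" using ybox[of s] X(1) by force
      qed
      also have "\<dots> = a * int (card X) + (\<Sum>s\<in>X. y2 s + y3 s)"
        by (simp add: sum.distrib algebra_simps)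
      also have "(\<Sum>s\<in>X. y2 s + y3 s) \<le> (\<Sum>s\<in>S. y2 s + y3 s)"
        using X(1) fin ybox by (intro sum_mono2) auto
      finally show ?thesis using X(3) \<open>card (X - S) = 0\<close> by simp
    qed
    moreover have "(\<Sum>s\<in>S. y1 s + y2 s + y3 s) = v" using mem pS by (simp add: mconvex_set_iff)
    ultimately show ?thesis
      using total unfolding sum3 by (simp add: sum_copies sum.distrib sum_subtractf)
  qed
  then have "is_arg_min (\<lambda>(x1, x2, x3). (\<Sum>s\<in>S. a - x1 s) + (\<Sum>s\<in>S. x3 s))
      (\<lambda>x. x \<in> split_vectors S p a) (?r Low, ?r Mid, ?r High)"
    using split by (auto simp: is_arg_min_linorder)
  then show ?thesis
    using step2_condition_if_linear_minimizer[OF fin _ z] z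
    unfolding step2_by_linear_minimization_def by blast
qed

section \<open>Cost bounds\<close>

text \<open>
  Here \<open>N\<close> stands for a bound on the size of the ground set plus the cost of an evaluation, and \<open>Q\<close> for
  the value of \<open>q\<close> at \<open>N\<close>. Over an arbitrary semiring, the same expressions are numbers in the
  analysis of the program and polynomials in the final bound.
\<close>

definition split_cost :: "'a :: comm_semiring_1 \<Rightarrow> 'a \<Rightarrow> 'a" where
  "split_cost Q N = Q * (2 * N + 3) + (2 * N + 2)"

definition step2_cost :: "'a :: comm_semiring_1 \<Rightarrow> 'a \<Rightarrow> 'a" where
  "step2_cost Q N = 3 * N * (split_cost Q N + 1) + 2 * N"

definition exchange_cost :: "'a :: comm_semiring_1 \<Rightarrow> 'a \<Rightarrow> 'a" where
  "exchange_cost Q N = Q * (N + 2) + (N + 4)"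

definition call_cost :: "'a :: comm_semiring_1 \<Rightarrow> 'a \<Rightarrow> 'a" where
  "call_cost Q N = (N + 1) + step2_cost Q N + 3 + 2 * N + 2 * (N * (N * exchange_cost Q N)) + N"

lemmas cost_defs = split_cost_def step2_cost_def exchange_cost_def call_cost_def

section \<open>Correctness and cost of the program\<close>

locale supermodular_evaluation = computation answer sfm q
  for answer :: "'s set \<Rightarrow> int option" and sfm q +
  fixes xs :: "'s list" and ev :: "'s set \<Rightarrow> (int, 's) expr" and p :: "'s set \<Rightarrow> int option"
    and N :: nat
  assumes distinct: "distinct xs" and supermodular: "supermodular (set xs) p"
    and ev_value: "\<And>X. expr_value answer (ev X) = p X"
    and cost: "\<And>X. expr_cost (ev X) + length xs \<le> N"
begin

lemma length_le: "length xs \<le> N"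
  using cost[of "{}"] by simp

lemma card_subset_le: "X \<subseteq> set xs \<Longrightarrow> card X \<le> N"
  using card_mono[of "set xs" X] card_length[of xs] length_le by simp

lemma length_filter_le_N: "length (filter P xs) + expr_cost (ev X) \<le> N"
  using cost[of X] length_filter_le[of P xs] by linarith

text \<open>
  Both functions handed to the minimization subroutine are a modular function minus \<open>p\<close>, shifted
  by a fixed set \<open>A\<close> (which is empty in the exchange test).
\<close>

lemma submodular_modular_minus:
  assumes "A \<union> T \<subseteq> set xs"
    and f: "\<And>U. U \<subseteq> T \<Longrightarrow> f U = map_option (\<lambda>v. c + sum g (A \<union> U) - v) (p (A \<union> U))"
  shows "submodular T f"
  unfolding submodular_def
proof (intro allI impI)
  fix X Y u v assume XY: "X \<subseteq> T" "Y \<subseteq> T" "f X = Some u" "f Y = Some v"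
  then obtain u' v' where uv: "p (A \<union> X) = Some u'" "u = c + sum g (A \<union> X) - u'"
    "p (A \<union> Y) = Some v'" "v = c + sum g (A \<union> Y) - v'"
    by (auto simp: f)
  have sub: "A \<union> X \<subseteq> set xs" "A \<union> Y \<subseteq> set xs" using XY assms(1) by auto
  obtain k l where kl: "p ((A \<union> X) \<inter> (A \<union> Y)) = Some k" "p ((A \<union> X) \<union> (A \<union> Y)) = Some l"
    "u' + v' \<le> k + l"
    using supermodularD[OF supermodular sub uv(1,3)] by (elim exE conjE)
  have eq: "(A \<union> X) \<inter> (A \<union> Y) = A \<union> (X \<inter> Y)" "(A \<union> X) \<union> (A \<union> Y) = A \<union> (X \<union> Y)" by auto
  have "sum g (A \<union> (X \<union> Y)) + sum g (A \<union> (X \<inter> Y)) = sum g (A \<union> X) + sum g (A \<union> Y)"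
    unfolding eq[symmetric] using sub by (intro sum.union_inter) (auto intro: finite_subset)
  moreover have "f (X \<inter> Y) = Some (c + sum g (A \<union> (X \<inter> Y)) - k)"
    "f (X \<union> Y) = Some (c + sum g (A \<union> (X \<union> Y)) - l)"
    using XY(1,2) kl(1,2) by (simp_all add: f eq le_infI1)
  ultimately show "\<exists>k l. f (X \<inter> Y) = Some k \<and> f (X \<union> Y) = Some l \<and> k + l \<le> u + v"
    using uv(2,4) kl(3) by (intro exI conjI) (assumption, assumption, linarith)
qed

lemma lift2_minus: "lift2 (-) (Some c) w = map_option (\<lambda>v. c - v) w"
  by (cases w) simp_all

lemma halts_exchange_prog:
  assumes "z \<in> mconvex_set (set xs) p" "s \<in> set xs" "t \<in> set xs"
  shows "halts_within (exchange_prog xs ev z s t) (exchange_cost (poly q N) N)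
    (\<lambda>b. b \<longleftrightarrow> exchange z s t \<in> mconvex_set (set xs) p)"
proof -
  define y where "y = exchange z s t"
  define f where "f X = Minus (sum_expr (\<lambda>r. Val (y r)) (filter (\<lambda>r. r \<in> X) xs)) (ev X)" for X
  have val: "expr_value answer (f X) = map_option (\<lambda>v. 0 + sum y ({} \<union> X) - v) (p ({} \<union> X))"
    if "X \<subseteq> set xs" for X
    using expr_value_sum_expr_filter[OF distinct that, of "\<lambda>r. Val (y r)" y]
    by (simp add: f_def lift2_minus ev_value)
  have f_cost: "expr_cost (f X) \<le> N + 1" for X
    using length_filter_le_N[of "\<lambda>r. r \<in> X" X] by (simp add: f_def expr_cost_sum_expr)
  have p0: "p {} = Some 0" using supermodular by (simp add: supermodular_def)
  have min: "halts_within (minimizer (set xs) f) (poly q N * (1 + (N + 1)))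
     (\<lambda>U. U \<subseteq> set xs \<and> (\<exists>m. expr_value answer (f U) = Some m \<and>
       (\<forall>X v. X \<subseteq> set xs \<longrightarrow> expr_value answer (f X) = Some v \<longrightarrow> m \<le> v)))"
    by (rule halts_minimizer[where W = "{}"])
      (use val f_cost p0 card_subset_le in \<open>auto intro!: submodular_modular_minus[where A = "{}" and c = 0 and g = y]\<close>)
  have mem: "y \<in> mconvex_set (set xs) p \<longleftrightarrow> 0 \<le> m"
    if U: "U \<subseteq> set xs" "expr_value answer (f U) = Some m"
      "\<forall>X v. X \<subseteq> set xs \<longrightarrow> expr_value answer (f X) = Some v \<longrightarrow> m \<le> v" for U m
  proof -
    have "p (set xs) = Some (sum y (set xs))"
      using assms by (simp add: mconvex_set_iff y_def sum_exchange)
    then have "y \<in> mconvex_set (set xs) p \<longleftrightarrow>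
        (\<forall>X v. X \<subseteq> set xs \<longrightarrow> expr_value answer (f X) = Some v \<longrightarrow> 0 \<le> v)"
      unfolding mconvex_set_iff by (auto simp: val)
    also have "\<dots> \<longleftrightarrow> 0 \<le> m" using U by (meson order_trans)
    finally show ?thesis .
  qed
  have y_eq: "(z(s := z s + 1))(t := (z(s := z s + 1)) t - 1) = y"
    by (auto simp: y_def exchange_def fun_eq_iff)
  have "exchange_prog xs ev z s t =
     compute Zero \<bind> (\<lambda>zero. compute (Plus (Val (z s)) One) \<bind> (\<lambda>i.
       compute (Minus (Val ((z(s := i)) t)) One) \<bind> (\<lambda>d.
         let y = (z(s := i))(t := d);
             f = (\<lambda>X. Minus (sum_expr (\<lambda>r. Val (y r)) (filter (\<lambda>r. r \<in> X) xs)) (ev X))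
         in minimizer (set xs) f \<bind> (\<lambda>U. compute (f U) \<bind> (\<lambda>m. leq zero m)))))"
    by (simp only: exchange_prog_def Let_def)
  also have "halts_within \<dots> (exchange_cost (poly q N) N) (\<lambda>b. b \<longleftrightarrow> y \<in> mconvex_set (set xs) p)"
  proof (rule halts_bind[OF halts_compute[where v = 0 and K = 0]])
    fix zero :: int assume zero: "zero = 0"
    show "halts_within (compute (Plus (Val (z s)) One) \<bind> (\<lambda>i.
       compute (Minus (Val ((z(s := i)) t)) One) \<bind> (\<lambda>d.
         let y = (z(s := i))(t := d);
             f = (\<lambda>X. Minus (sum_expr (\<lambda>r. Val (y r)) (filter (\<lambda>r. r \<in> X) xs)) (ev X))
         in minimizer (set xs) f \<bind> (\<lambda>U. compute (f U) \<bind> (\<lambda>m. leq zero m)))))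
       (exchange_cost (poly q N) N - 0) (\<lambda>b. b \<longleftrightarrow> y \<in> mconvex_set (set xs) p)"
    proof (rule halts_bind[OF halts_compute[where v = "z s + 1" and K = 1]])
      fix i assume i: "i = z s + 1"
      show "halts_within (compute (Minus (Val ((z(s := i)) t)) One) \<bind> (\<lambda>d.
         let y = (z(s := i))(t := d);
             f = (\<lambda>X. Minus (sum_expr (\<lambda>r. Val (y r)) (filter (\<lambda>r. r \<in> X) xs)) (ev X))
         in minimizer (set xs) f \<bind> (\<lambda>U. compute (f U) \<bind> (\<lambda>m. leq zero m))))
         (exchange_cost (poly q N) N - 0 - 1) (\<lambda>b. b \<longleftrightarrow> y \<in> mconvex_set (set xs) p)"
      proof (rule halts_bind[OF halts_compute[where v = "(z(s := i)) t - 1" and K = 1]])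
        fix d assume d: "d = (z(s := i)) t - 1"
        have "halts_within (minimizer (set xs) f \<bind> (\<lambda>U. compute (f U) \<bind> (\<lambda>m. leq zero m)))
           (exchange_cost (poly q N) N - 0 - 1 - 1) (\<lambda>b. b \<longleftrightarrow> y \<in> mconvex_set (set xs) p)"
        proof (rule halts_bind[OF min])
          fix U assume "U \<subseteq> set xs \<and> (\<exists>m. expr_value answer (f U) = Some m \<and>
             (\<forall>X v. X \<subseteq> set xs \<longrightarrow> expr_value answer (f X) = Some v \<longrightarrow> m \<le> v))"
          then obtain m where m: "expr_value answer (f U) = Some m" and
            iff: "y \<in> mconvex_set (set xs) p \<longleftrightarrow> 0 \<le> m" using mem by (elim exE conjE) metis
          show "halts_within (compute (f U) \<bind> (\<lambda>m. leq zero m))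
             (exchange_cost (poly q N) N - 0 - 1 - 1 - poly q N * (1 + (N + 1)))
             (\<lambda>b. b \<longleftrightarrow> y \<in> mconvex_set (set xs) p)"
            by (rule halts_bind[OF halts_compute[OF m f_cost]], simp add: exchange_cost_def,
                rule halts_mono[OF halts_leq]) (simp_all add: exchange_cost_def zero iff)
        qed (simp add: exchange_cost_def)
        moreover have "(z(s := i))(t := d) = y" using y_eq i d by simp
        ultimately show "halts_within (let y = (z(s := i))(t := d);
             f = (\<lambda>X. Minus (sum_expr (\<lambda>r. Val (y r)) (filter (\<lambda>r. r \<in> X) xs)) (ev X))
           in minimizer (set xs) f \<bind> (\<lambda>U. compute (f U) \<bind> (\<lambda>m. leq zero m)))
           (exchange_cost (poly q N) N - 0 - 1 - 1) (\<lambda>b. b \<longleftrightarrow> y \<in> mconvex_set (set xs) p)"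
          by (simp only: Let_def f_def[abs_def])
      qed (simp_all add: exchange_cost_def)
    qed (simp_all add: exchange_cost_def)
  qed (simp_all add: exchange_cost_def)
  finally show ?thesis by (simp only: y_def)
qed

text \<open>
  The set-function is evaluated only at prefixes of the greedy order. For these, one of \<open>X = {}\<close>
  and \<open>X = S\<close> is feasible in the maximum, so that it is finite.
\<close>

lemma halts_split_function:
  assumes Y: "Y \<subseteq> UNIV \<times> set xs" and chain: "copy_part Low Y = {} \<or> copy_part High Y = set xs"
  shows "halts_within (split_function xs ev a Y) (split_cost (poly q N) N)
    (greatest_bound (split_bound (set xs) p a) Y)"
proof -
  define Y1 Y2 Y3 where Ys: "Y1 = copy_part Low Y" "Y2 = copy_part Mid Y" "Y3 = copy_part High Y"
  define pen :: "'s set \<Rightarrow> (int, 's) expr" where "pen U = Plus (sum_expr (\<lambda>_. Val a) (filter (\<lambda>s. s \<in> U) xs))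
    (sum_expr (\<lambda>_. One) (filter (\<lambda>s. s \<in> Y1 \<union> U - Y2) xs))" for U
  define f where "f U = Minus (pen U) (ev (Y1 \<union> U))" for U
  have sub: "Y1 \<subseteq> set xs" "Y3 \<subseteq> set xs" using Y by (auto simp: Ys copy_part_def)
  have Y13: "Y1 \<subseteq> Y3" using chain sub by (auto simp: Ys)
  let ?g = "\<lambda>s. a + of_bool (s \<notin> Y2)"
  let ?w = "\<lambda>U. a * int (card U) + int (card (Y1 \<union> U - Y2))"
  have pen: "expr_value answer (pen U) = Some (?w U)" if "U \<subseteq> Y3 - Y1" for U
  proof -
    have "expr_value answer (sum_expr (\<lambda>_. Val a) (filter (\<lambda>s. s \<in> U) xs)) = Some (\<Sum>s\<in>U. a)"
      using that sub by (intro expr_value_sum_expr_filter distinct) auto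
    moreover have "expr_value answer (sum_expr (\<lambda>_. One) (filter (\<lambda>s. s \<in> Y1 \<union> U - Y2) xs)) =
        Some (\<Sum>s\<in>Y1 \<union> U - Y2. 1)"
      using that sub by (intro expr_value_sum_expr_filter distinct) auto
    ultimately show ?thesis by (simp add: pen_def mult.commute)
  qed
  then have val: "expr_value answer (f U) = map_option (\<lambda>v. ?w U - v) (p (Y1 \<union> U))"
    if "U \<subseteq> Y3 - Y1" for U
    using that by (simp add: f_def lift2_minus ev_value)
  have w_modular: "?w U = - a * int (card Y1) + sum ?g (Y1 \<union> U)" if U: "U \<subseteq> Y3 - Y1" for U
  proof -
    have fin: "finite Y1" "finite U" using sub U by (auto intro: finite_subset)
    have "sum ?g (Y1 \<union> U) = (\<Sum>s\<in>Y1 \<union> U. a) + (\<Sum>s\<in>Y1 \<union> U. of_bool (s \<notin> Y2))" by (rule sum.distrib)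
    also have "(\<Sum>s\<in>Y1 \<union> U. of_bool (s \<notin> Y2)) = (\<Sum>s\<in>Y1 \<union> U - Y2. 1 :: int)"
      using fin by (intro sum.mono_neutral_cong_right) auto
    also have "(\<Sum>s\<in>Y1 \<union> U. a) = a * int (card Y1) + a * int (card U)"
      using fin U by (subst sum.union_disjoint) (auto simp: mult.commute)
    finally show ?thesis by simp
  qed
  have pen_cost: "expr_cost (pen U) \<le> 1 + length xs + length xs" for U
    by (simp add: pen_def expr_cost_sum_expr add_mono)
  have cost_le: "1 + expr_cost (pen U) + expr_cost (ev X) \<le> 2 * N + 2" for U X
    using pen_cost[of U] cost[of X] length_le by linarith
  obtain U0 where U0: "U0 \<subseteq> Y3 - Y1" "p (Y1 \<union> U0) \<noteq> None"
  proof (cases "Y1 = {}")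
    case True
    then show ?thesis using that[of "{}"] supermodular by (simp add: supermodular_def)
  next
    case False
    then have "Y3 = set xs" using chain by (simp add: Ys)
    then have "Y1 \<union> (Y3 - Y1) = set xs" using Y13 by blast
    then show ?thesis using that[of "Y3 - Y1"] supermodular by (simp add: supermodular_def)
  qed
  have min: "halts_within (minimizer (Y3 - Y1) f) (poly q N * (1 + (2 * N + 2)))
     (\<lambda>U. U \<subseteq> Y3 - Y1 \<and> (\<exists>m. expr_value answer (f U) = Some m \<and>
       (\<forall>X v. X \<subseteq> Y3 - Y1 \<longrightarrow> expr_value answer (f X) = Some v \<longrightarrow> m \<le> v)))"
  proof (rule halts_minimizer[where W = U0])
    show "submodular (Y3 - Y1) (\<lambda>X. expr_value answer (f X))"
      using sub by (intro submodular_modular_minus[where A = Y1 and g = ?g and c = "- a * int (card Y1)"])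
        (auto simp: val w_modular)
    show "expr_cost (f X) \<le> 2 * N + 2" for X using cost_le by (simp add: f_def)
    show "card (Y3 - Y1) \<le> N" using sub by (intro card_subset_le) auto
  qed (use sub U0 val[OF U0(1)] in \<open>auto intro: finite_subset\<close>)
  have split_function_eq: "split_function xs ev a Y =
      minimizer (Y3 - Y1) f \<bind> (\<lambda>U. compute (Minus (ev (Y1 \<union> U)) (pen U)))"
    by (simp add: split_function_def Let_def f_def[abs_def] pen_def[abs_def] Ys)
  have bound_iff: "split_bound (set xs) p a Y w \<longleftrightarrow>
      (\<exists>U u. U \<subseteq> Y3 - Y1 \<and> p (Y1 \<union> U) = Some u \<and> w = u - ?w U)" (is "?L \<longleftrightarrow> ?R") for w
  proof
    assume ?L
    then obtain X u where X: "Y1 \<subseteq> X" "X \<subseteq> Y3" "p X = Some u"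
      "w = u - a * int (card (X - Y1)) - int (card (X - Y2))"
      unfolding split_bound_def Ys by (elim exE conjE)
    then have "Y1 \<union> (X - Y1) = X" by blast
    then show ?R using X by (intro exI[of _ "X - Y1"] exI[of _ u]) auto
  next
    assume ?R
    then obtain U u where U: "U \<subseteq> Y3 - Y1" "p (Y1 \<union> U) = Some u" "w = u - ?w U" by (elim exE conjE)
    then have "Y1 \<union> U - Y1 = U" by blast
    then show ?L
      using U Y13 sub unfolding split_bound_def Ys[symmetric]
      by (intro exI[of _ "Y1 \<union> U"] exI[of _ u]) auto
  qed
  show ?thesis
    unfolding split_function_eq
  proof (rule halts_bind[OF min])
    fix U assume "U \<subseteq> Y3 - Y1 \<and> (\<exists>m. expr_value answer (f U) = Some m \<and>
       (\<forall>X v. X \<subseteq> Y3 - Y1 \<longrightarrow> expr_value answer (f X) = Some v \<longrightarrow> m \<le> v))"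
    then obtain m where U: "U \<subseteq> Y3 - Y1" "expr_value answer (f U) = Some m"
      "\<And>X v. X \<subseteq> Y3 - Y1 \<Longrightarrow> expr_value answer (f X) = Some v \<Longrightarrow> m \<le> v" by metis
    then obtain u where u: "p (Y1 \<union> U) = Some u" "m = ?w U - u" by (auto simp: val)
    have le: "v - ?w X \<le> u - ?w U" if "X \<subseteq> Y3 - Y1" "p (Y1 \<union> X) = Some v" for X v
      using U(3)[of X "?w X - v"] that u(2) by (simp add: val)
    have "greatest_bound (split_bound (set xs) p a) Y (u - ?w U)"
      unfolding greatest_bound_def bound_iff
    proof (intro conjI allI impI)
      show "\<exists>U' u'. U' \<subseteq> Y3 - Y1 \<and> p (Y1 \<union> U') = Some u' \<and> u - ?w U = u' - ?w U'"
        using U(1) u(1) by (intro exI[of _ U] exI[of _ u]) simp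
      fix w' assume "\<exists>U u. U \<subseteq> Y3 - Y1 \<and> p (Y1 \<union> U) = Some u \<and> w' = u - ?w U"
      then show "w' \<le> u - ?w U" using le by (elim exE conjE) simp
    qed
    moreover have "split_cost (poly q N) N - poly q N * (1 + (2 * N + 2)) = 2 * N + 2"
      by (simp add: split_cost_def algebra_simps)
    ultimately show "halts_within (compute (Minus (ev (Y1 \<union> U)) (pen U)))
        (split_cost (poly q N) N - poly q N * (1 + (2 * N + 2)))
        (greatest_bound (split_bound (set xs) p a) Y)"
      using cost_le[of U "Y1 \<union> U"]
      by (intro halts_mono[OF halts_compute[where v = "u - ?w U" and K = "2 * N + 2"]])
        (simp_all add: ev_value u(1) pen[OF U(1)])
  qed (simp add: split_cost_def algebra_simps)
qed

lemma halts_step2_prog: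
  "halts_within (step2_prog xs ev a) (step2_cost (poly q N) N)
     (step2_by_linear_minimization (set xs) p a)"
proof -
  let ?es = "map (Pair High) xs @ map (Pair Mid) xs @ map (Pair Low) xs"
  let ?G = "split_bound (set xs) p a"
  let ?K = "split_cost (poly q N) N"
  have es: "set ?es = UNIV \<times> set xs" "distinct ?es" "length ?es = 3 * length xs"
    using distinct by (auto simp: UNIV_copy distinct_map inj_on_def)
  have chain: "copy_part Low (set ys) = {} \<or> copy_part High (set ys) = set xs"
    and prefix_sub: "set ys \<subseteq> UNIV \<times> set xs" if "?es = ys @ zs" for ys zs
  proof -
    show ys: "set ys \<subseteq> UNIV \<times> set xs"
      using that es(1) by (metis set_append sup_ge1)
    have "(map (Pair High) xs @ map (Pair Mid) xs) @ map (Pair Low) xs = ys @ zs"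
      using that by simp
    then consider us where "ys @ us = map (Pair High) xs @ map (Pair Mid) xs"
      | us where "ys = (map (Pair High) xs @ map (Pair Mid) xs) @ us"
      unfolding append_eq_append_conv2 by metis
    then show "copy_part Low (set ys) = {} \<or> copy_part High (set ys) = set xs"
    proof cases
      case 1
      then have "set ys \<subseteq> set (map (Pair High) xs @ map (Pair Mid) xs)"
        by (metis set_append sup_ge1)
      then show ?thesis by (auto simp: copy_part_def)
    next
      case 2
      then show ?thesis using ys by (auto simp: copy_part_def)
    qed
  qed
  have "halts_within (greedy (split_function xs ev a) {} 0 ?es (\<lambda>_. 0)) (length ?es * (?K + 1))
    (\<lambda>r. (\<forall>Z u. Z \<subseteq> {} \<union> set ?es \<longrightarrow> ?G Z u \<longrightarrow> u \<le> sum r Z) \<and>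
         (\<forall>ys zs. ?es = ys @ zs \<longrightarrow> greatest_bound ?G ({} \<union> set ys) (sum r ({} \<union> set ys))) \<and>
         (\<forall>e. e \<notin> set ?es \<longrightarrow> r e = (\<lambda>_. 0) e))"
  proof (rule halts_greedy)
    show "supermodular_bounds ?G" using supermodular by (intro supermodular_split_bound) simp_all
    show "halts_within (split_function xs ev a (insert e ({} \<union> set ys))) ?K
        (greatest_bound ?G (insert e ({} \<union> set ys)))" if "?es = ys @ e # zs" for ys e zs
    proof -
      have "?es = (ys @ [e]) @ zs" using that by simp
      from chain[OF this] prefix_sub[OF this] show ?thesis
        by (intro halts_split_function) simp_all
    qed
    have "p {} = Some 0" using supermodular by (simp add: supermodular_def)
    then show "greatest_bound ?G {} 0"
      by (auto simp: greatest_bound_def split_bound_def copy_part_simps)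
    show "u \<le> (\<Sum>e\<in>Z. 0)" if "Z \<subseteq> {}" "?G Z u" for Z u
      using that \<open>greatest_bound ?G {} 0\<close> by (simp add: greatest_bound_def)
  qed (use es in simp_all)
  then have greedy: "halts_within (greedy (split_function xs ev a) {} 0 ?es (\<lambda>_. 0))
      (3 * N * (?K + 1)) (\<lambda>r. (\<forall>Z u. Z \<subseteq> UNIV \<times> set xs \<longrightarrow> ?G Z u \<longrightarrow> u \<le> sum r Z) \<and>
         (\<forall>ys zs. ?es = ys @ zs \<longrightarrow> greatest_bound ?G (set ys) (sum r (set ys))))"
  proof (rule halts_mono)
    show "length ?es * (?K + 1) \<le> 3 * N * (?K + 1)"
      using length_le unfolding es(3) by (intro mult_le_mono) simp_all
  qed (use es(1) in simp)
  have step2: "step2_by_linear_minimization (set xs) p a z"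
    if r: "(\<forall>Z u. Z \<subseteq> UNIV \<times> set xs \<longrightarrow> ?G Z u \<longrightarrow> u \<le> sum r Z) \<and>
         (\<forall>ys zs. ?es = ys @ zs \<longrightarrow> greatest_bound ?G (set ys) (sum r (set ys)))"
      and z: "\<forall>s\<in>set xs. z s = r (Low, s) + r (Mid, s) + r (High, s)" for r z
  proof (rule greedy_splitting_optimal[OF _ supermodular _ _ _ _ z])
    have prefix: "greatest_bound ?G (set ys) (sum r (set ys))" if "?es = ys @ zs" for ys zs
      using conjunct2[OF r, rule_format, OF that] .
    have "set (map (Pair High) xs) = {High} \<times> set xs"
      "set (map (Pair High) xs @ map (Pair Mid) xs) = {High, Mid} \<times> set xs" by auto
    then show "greatest_bound ?G ({High} \<times> set xs) (sum r ({High} \<times> set xs))"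
      "greatest_bound ?G ({High, Mid} \<times> set xs) (sum r ({High, Mid} \<times> set xs))"
      using prefix[of "map (Pair High) xs"] prefix[of "map (Pair High) xs @ map (Pair Mid) xs"]
      by simp_all
    show "greatest_bound ?G (UNIV \<times> set xs) (sum r (UNIV \<times> set xs))"
      using prefix[of ?es "[]"] unfolding es(1) by simp
    show "u \<le> sum r Z" if "Z \<subseteq> UNIV \<times> set xs" "?G Z u" for Z u
      using conjunct1[OF r, rule_format, OF that] .
  qed simp
  show ?thesis
    unfolding step2_prog_def
  proof (rule halts_bind[OF halts_compute[where v = 0 and K = 0]])
    fix zero :: int assume zero: "zero = 0"
    let ?sum = "\<lambda>r s. Plus (Plus (Val (r (Low, s))) (Val (r (Mid, s)))) (Val (r (High, s)))"
    show "halts_within (greedy (split_function xs ev a) {} zero ?es (\<lambda>_. zero) \<bind>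
          (\<lambda>r. vector_prog (?sum r) xs (\<lambda>_. zero))) (step2_cost (poly q N) N - 0)
        (step2_by_linear_minimization (set xs) p a)"
      unfolding zero
    proof (rule halts_bind[OF greedy])
      fix r assume r: "(\<forall>Z u. Z \<subseteq> UNIV \<times> set xs \<longrightarrow> ?G Z u \<longrightarrow> u \<le> sum r Z) \<and>
         (\<forall>ys zs. ?es = ys @ zs \<longrightarrow> greatest_bound ?G (set ys) (sum r (set ys)))"
      show "halts_within (vector_prog (?sum r) xs (\<lambda>_. 0))
          (step2_cost (poly q N) N - 0 - 3 * N * (?K + 1)) (step2_by_linear_minimization (set xs) p a)"
        by (rule halts_mono[OF halts_vector_prog[where K = 2 and
                g = "\<lambda>s. r (Low, s) + r (Mid, s) + r (High, s)"]])
          (use length_le step2[OF r] in \<open>simp_all add: step2_cost_def\<close>)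
    qed (simp add: step2_cost_def)
  qed simp_all
qed

end

context computation
begin

text \<open>
  The recursive calls form a tree with at most \<open>2 |S| - 1\<close> nodes, since the two ground sets are disjoint
  proper subsets. The bound \<open>N\<close> holds for all of them: a contraction makes evaluations more
  expensive by one operation, but its ground set is smaller by at least one element.
\<close>

lemma halts_decomposition_algorithm:
  assumes "supermodular_evaluation answer sfm xs ev p N" "xs \<noteq> []"
  shows "halts_within (decomposition_algorithm xs ev)
    ((2 * length xs - 1) * call_cost (poly q N) N)
    (decomposition_output step2_by_linear_minimization (set xs) p)"
  using assms
proof (induction "length xs" arbitrary: xs ev p rule: less_induct)
  case less
  interpret supermodular_evaluation answer sfm q xs ev p N by (rule less.prems(1))
  let ?S = "set xs" and ?L = "call_cost (poly q N) N"
  let ?E = "exchange_cost (poly q N) N"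
  let ?dec = "decomposition_output step2_by_linear_minimization"
  obtain v where pS: "p ?S = Some v" using supermodular by (auto simp: supermodular_def)
  define a where "a = v div int (length xs)"
  have floor: "a = \<lfloor>real_of_int v / real (card ?S)\<rfloor>"
    using floor_divide_of_int_eq[of v "int (length xs)", where ?'a = real] distinct
    by (simp add: a_def distinct_card)
  have a: "expr_value answer (Div (ev ?S) (sum_expr (\<lambda>_. One) xs)) = Some a"
    using expr_value_sum_expr[of xs "\<lambda>_. One" "\<lambda>_. 1"]
    by (simp add: ev_value pS a_def sum_list_triv)
  have hi: "expr_value answer (Plus (Plus (Val a) One) One) = Some (a + 1 + 1)"
    and lo: "expr_value answer (Minus (Val a) One) = Some (a - 1)" by simp_all
  have a_cost: "expr_cost (Div (ev ?S) (sum_expr (\<lambda>_. One) xs)) \<le> N + 1"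
    using cost[of ?S] by (simp add: expr_cost_sum_expr)

  obtain z k2 where z: "exec answer sfm q (step2_prog xs ev a) = Some (z, k2)"
    "k2 \<le> step2_cost (poly q N) N" "step2_by_linear_minimization ?S p a z"
    using halts_step2_prog[of a] unfolding halts_within_def by (elim exE conjE)
  have st: "step2_condition ?S p a z" using z(3) by (simp add: step2_by_linear_minimization_def)
  then have z_mem: "z \<in> mconvex_set ?S p" by (simp add: step2_condition_def)

  let ?ts = "filter (\<lambda>t. a + 1 + 1 \<le> z t) xs" and ?ss = "filter (\<lambda>s. z s \<le> a - 1) xs"
  obtain k3 where k3: "exec answer sfm q (filter_prog (\<lambda>t. leq (a + 1 + 1) (z t)) xs) = Some (?ts, k3)"
    "k3 \<le> N"
  proof -
    have "halts_within (filter_prog (\<lambda>t. leq (a + 1 + 1) (z t)) xs) (length xs * 1) (\<lambda>r. r = ?ts)"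
      by (rule halts_filter_prog) (rule halts_leq)
    then show ?thesis using that length_le unfolding halts_within_def by auto
  qed
  obtain k4 where k4: "exec answer sfm q (filter_prog (\<lambda>s. leq (z s) (a - 1)) xs) = Some (?ss, k4)"
    "k4 \<le> N"
  proof -
    have "halts_within (filter_prog (\<lambda>s. leq (z s) (a - 1)) xs) (length xs * 1) (\<lambda>r. r = ?ss)"
      by (rule halts_filter_prog) (rule halts_leq)
    then show ?thesis using that length_le unfolding halts_within_def by auto
  qed

  define xsp where "xsp = filter (\<lambda>s. \<exists>t\<in>set ?ts. exchange z s t \<in> mconvex_set ?S p) xs"
  define xsm where "xsm = filter (\<lambda>t. \<exists>s\<in>set ?ss. exchange z s t \<in> mconvex_set ?S p) xs"
  have Sp: "set xsp = S_plus ?S p a z" by (auto simp: xsp_def S_plus_def)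
  have Sm: "set xsm = S_minus ?S p a z" by (auto simp: xsm_def S_minus_def)
  have exists_le: "length (filter P xs) * ?E \<le> N * ?E" for P
    using length_filter_le[of P xs] length_le by (intro mult_le_mono1) linarith
  have filter_le: "length xs * (N * ?E) \<le> N * (N * ?E)" using length_le by (rule mult_le_mono1)
  obtain k5 where k5: "exec answer sfm q
      (filter_prog (\<lambda>s. exists_prog (\<lambda>t. exchange_prog xs ev z s t) ?ts) xs) = Some (xsp, k5)"
    "k5 \<le> N * (N * ?E)"
  proof -
    have "halts_within (exists_prog (\<lambda>t. exchange_prog xs ev z s t) ?ts) (N * ?E)
        (\<lambda>b. b \<longleftrightarrow> (\<exists>t\<in>set ?ts. exchange z s t \<in> mconvex_set ?S p))" if "s \<in> ?S" for s
    proof (rule halts_mono[OF halts_exists_prog exists_le])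
      show "halts_within (exchange_prog xs ev z s t) ?E (\<lambda>b. b \<longleftrightarrow> exchange z s t \<in> mconvex_set ?S p)"
        if "t \<in> set ?ts" for t
        using that by (intro halts_exchange_prog z_mem \<open>s \<in> ?S\<close>) simp
    qed
    then have "halts_within (filter_prog (\<lambda>s. exists_prog (\<lambda>t. exchange_prog xs ev z s t) ?ts) xs)
        (length xs * (N * ?E)) (\<lambda>r. r = xsp)"
      unfolding xsp_def by (rule halts_filter_prog)
    then show ?thesis using that order_trans[OF _ filter_le] unfolding halts_within_def by blast
  qed
  obtain k6 where k6: "exec answer sfm q
      (filter_prog (\<lambda>t. exists_prog (\<lambda>s. exchange_prog xs ev z s t) ?ss) xs) = Some (xsm, k6)"
    "k6 \<le> N * (N * ?E)"
  proof -
    have "halts_within (exists_prog (\<lambda>s. exchange_prog xs ev z s t) ?ss) (N * ?E)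
        (\<lambda>b. b \<longleftrightarrow> (\<exists>s\<in>set ?ss. exchange z s t \<in> mconvex_set ?S p))" if "t \<in> ?S" for t
    proof (rule halts_mono[OF halts_exists_prog exists_le])
      show "halts_within (exchange_prog xs ev z s t) ?E (\<lambda>b. b \<longleftrightarrow> exchange z s t \<in> mconvex_set ?S p)"
        if "s \<in> set ?ss" for s
        using that by (intro halts_exchange_prog z_mem \<open>t \<in> ?S\<close>) simp
    qed
    then have "halts_within (filter_prog (\<lambda>t. exists_prog (\<lambda>s. exchange_prog xs ev z s t) ?ss) xs)
        (length xs * (N * ?E)) (\<lambda>r. r = xsm)"
      unfolding xsm_def by (rule halts_filter_prog)
    then show ?thesis using that order_trans[OF _ filter_le] unfolding halts_within_def by blast
  qed

  have S_ne: "?S \<noteq> {}" using less.prems(2) by simp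
  have dist: "distinct xsp" "distinct xsm" using distinct by (simp_all add: xsp_def xsm_def)
  have psub: "set xsp \<subset> ?S" "set xsm \<subset> ?S" and disj: "set xsp \<inter> set xsm = {}"
    using S_plus_psubset[OF _ S_ne st pS floor] S_minus_psubset[OF _ S_ne st pS floor]
      S_plus_S_minus_disjoint[OF st] by (simp_all add: Sp Sm)
  have shorter: "length xsp < length xs" "length xsm < length xs"
    using psub[THEN psubset_card_mono[rotated]] dist distinct by (simp_all add: distinct_card)
  have split_length: "length xsp + length xsm \<le> length xs"
  proof -
    have "card (set xsp \<union> set xsm) \<le> card ?S" using psub by (intro card_mono) auto
    then show ?thesis
      using disj dist distinct by (simp add: card_Un_disjoint distinct_card)
  qed

  \<comment> \<open>\<open>2 * 0 - 1 = 0\<close> on natural numbers: an omitted call contributes nothing to the cost.\<close>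
  let ?zp = "if xsp = [] then Ret z
            else if length xsp < length xs then decomposition_algorithm xsp ev
            else Fail"
  obtain zp k7 where zp: "exec answer sfm q ?zp = Some (zp, k7)"
    "k7 \<le> (2 * length xsp - 1) * ?L" "xsp \<noteq> [] \<longrightarrow> ?dec (set xsp) p zp"
  proof (cases "xsp = []")
    case True
    then show ?thesis using that by simp
  next
    case False
    have "supermodular_evaluation answer sfm xsp ev p N"
    proof
      show "supermodular (set xsp) p"
        unfolding Sp by (rule supermodular_S_plus[OF _ supermodular st]) simp
      show "expr_cost (ev X) + length xsp \<le> N" for X using cost[of X] shorter(1) by linarith
    qed (rule dist ev_value)+
    then have "halts_within (decomposition_algorithm xsp ev) ((2 * length xsp - 1) * ?L)
        (?dec (set xsp) p)"
      using less.hyps[OF shorter(1)] False by blast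
    then show ?thesis using that False shorter(1) unfolding halts_within_def by auto
  qed

  obtain w where w: "p (?S - set xsm) = Some w"
    using finite_value_complement_S_minus[OF _ supermodular st] by (auto simp: Sm)
  let ?evm = "\<lambda>w X. Minus (ev (X \<union> (?S - set xsm))) (Val w)"
  let ?zm = "if xsm = [] then Ret z
            else if length xsm < length xs then do {
              w \<leftarrow> compute (ev (?S - set xsm));
              decomposition_algorithm xsm (?evm w)
            }
            else Fail"
  obtain zm k8 where zm: "exec answer sfm q ?zm = Some (zm, k8)"
    "k8 \<le> (2 * length xsm - 1) * ?L + N" "xsm \<noteq> [] \<longrightarrow> ?dec (set xsm) (contraction ?S p (set xsm)) zm"
  proof (cases "xsm = []")
    case True
    then show ?thesis using that by simp
  next
    case False
    have "supermodular_evaluation answer sfm xsm (?evm w) (contraction ?S p (set xsm)) N"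
    proof
      show "supermodular (set xsm) (contraction ?S p (set xsm))"
        unfolding Sm by (rule supermodular_contraction_S_minus[OF _ supermodular st]) simp
      show "expr_value answer (?evm w X) = contraction ?S p (set xsm) X" for X
        using w by (cases "p (X \<union> (?S - set xsm))") (simp_all add: contraction_def ev_value)
      show "expr_cost (?evm w X) + length xsm \<le> N" for X
        using cost[of "X \<union> (?S - set xsm)"] shorter(2) by simp
    qed (rule dist)
    then have "halts_within (decomposition_algorithm xsm (?evm w)) ((2 * length xsm - 1) * ?L)
        (?dec (set xsm) (contraction ?S p (set xsm)))"
      using less.hyps[OF shorter(2)] False by blast
    then obtain r k where "exec answer sfm q (decomposition_algorithm xsm (?evm w)) = Some (r, k)"
      "k \<le> (2 * length xsm - 1) * ?L" "?dec (set xsm) (contraction ?S p (set xsm)) r"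
      unfolding halts_within_def by (elim exE conjE)
    then show ?thesis
      using that[of r "expr_cost (ev (?S - set xsm)) + k"] False shorter(2) cost[of "?S - set xsm"] w
      by (simp add: exec_bind exec_compute ev_value)
  qed

  define y where "y = (\<lambda>s. if s \<in> set xsp then zp s else if s \<in> set xsm then zm s else z s)"
  have "?dec ?S p y"
  proof (rule decomposition_output.intros[where v = v and a = a and z = z])
    show "set xsp \<noteq> {} \<longrightarrow> ?dec (set xsp) p y"
      using zp(3) by (auto simp: y_def elim!: decomposition_output_cong)
    show "set xsm \<noteq> {} \<longrightarrow> ?dec (set xsm) (contraction ?S p (set xsm)) y"
      using zm(3) disj by (auto simp: y_def elim!: decomposition_output_cong)
  qed (use pS floor z(3) Sp Sm in \<open>simp_all add: y_def\<close>)
  moreover have "exec answer sfm q (decomposition_algorithm xs ev) =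
      Some (y, expr_cost (Div (ev ?S) (sum_expr (\<lambda>_. One) xs)) + (k2 + (2 + (1 + (k3 + (k4 + (k5 + (k6 + (k7 + k8)))))))))"
    by (simp only: decomposition_algorithm.simps[of xs ev] exec_bind exec_compute a hi lo z(1) k3(1)
        k4(1) k5(1) k6(1) zp(1) zm(1) option.case option.map prod.case exec.simps(1) y_def
        expr_cost.simps add_0_right add_0_left one_add_one)
  moreover have "expr_cost (Div (ev ?S) (sum_expr (\<lambda>_. One) xs)) + (k2 + (2 + (1 + (k3 + (k4 + (k5 + (k6 + (k7 + k8)))))))) \<le>
      (2 * length xs - 1) * ?L"
  proof -
    have "(2 * length xsp - 1) + (2 * length xsm - 1) + 1 \<le> 2 * length xs - 1"
      using split_length shorter less.prems(2) by (cases xs) auto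
    then have "((2 * length xsp - 1) + (2 * length xsm - 1) + 1) * ?L \<le> (2 * length xs - 1) * ?L"
      by (rule mult_le_mono1)
    then have "(2 * length xsp - 1) * ?L + (2 * length xsm - 1) * ?L + ?L \<le> (2 * length xs - 1) * ?L"
      by (simp only: distrib_right mult_1)
    moreover have "?L = N + 1 + step2_cost (poly q N) N + 3 + 2 * N + 2 * (N * (N * ?E)) + N"
      by (rule call_cost_def)
    ultimately show ?thesis
      using a_cost z(2) k3(2) k4(2) k5(2) k6(2) zp(2) zm(2) by linarith
  qed
  ultimately show ?case unfolding halts_within_def by blast
qed

end

theorem proposition5p8:
  fixes q :: "nat poly"
  shows
    "(\<forall>(S :: 's set) p z.
        finite S \<longrightarrow> S \<noteq> {} \<longrightarrow> supermodular S p \<longrightarrow>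
        decomposition_output step2_condition S p z \<longrightarrow>
          is_arg_min (square_sum S) (\<lambda>x. x \<in> mconvex_set S p) z \<and>
          decreasingly_minimal S (mconvex_set S p) z) \<and>
     (\<exists>r :: nat poly. \<forall>(S :: 's set) xs p sfm.
        finite S \<longrightarrow> S \<noteq> {} \<longrightarrow> set xs = S \<longrightarrow> distinct xs \<longrightarrow>
        supermodular S p \<longrightarrow> minimizes_submodular sfm \<longrightarrow>
        (\<exists>z cost.
          exec p sfm q (decomposition_algorithm xs Query) = Some (z, cost) \<and>
          decomposition_output step2_by_linear_minimization S p z \<and>
          is_arg_min (square_sum S) (\<lambda>x. x \<in> mconvex_set S p) z \<and>
          decreasingly_minimal S (mconvex_set S p) z \<and>
          cost \<le> poly r (card S)))"
proof -
  have optimal: "is_arg_min (square_sum S) (\<lambda>x. x \<in> mconvex_set S p) z \<and>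
      decreasingly_minimal S (mconvex_set S p) z"
    if "finite S" "supermodular S p" "decomposition_output step2_condition S p z"
    for S :: "'s set" and p z
    using decomposition_output_balanced[OF that(3,1,2)] that(1,2)
    by (simp add: balanced_minimizes_square_sum balanced_decreasingly_minimal)
  define r where "r = [:0, 2:] * call_cost (q \<circ>\<^sub>p [:1, 1:]) [:1, 1:]"
  have "poly (call_cost P X) n = call_cost (poly P n) (poly X n)" for P X :: "nat poly" and n
    by (simp add: cost_defs)
  then have r: "poly r n = 2 * n * call_cost (poly q (n + 1)) (n + 1)" for n
    by (simp add: r_def poly_pcompose)
  have "\<exists>z cost.
          exec p sfm q (decomposition_algorithm xs Query) = Some (z, cost) \<and>
          decomposition_output step2_by_linear_minimization S p z \<and>
          is_arg_min (square_sum S) (\<lambda>x. x \<in> mconvex_set S p) z \<and>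
          decreasingly_minimal S (mconvex_set S p) z \<and>
          cost \<le> poly r (card S)"
    if S: "finite S" "S \<noteq> {}" "set xs = S" "distinct xs" "supermodular S p" "minimizes_submodular sfm"
    for S :: "'s set" and xs p sfm
  proof -
    let ?N = "card S + 1"
    have len: "length xs = card S" using distinct_card[OF S(4)] S(3) by simp
    interpret computation p sfm q using S(6) by unfold_locales
    have "supermodular_evaluation p sfm xs Query p ?N"
      using S by unfold_locales (simp_all add: len)
    moreover have "xs \<noteq> []" using S(2,3) by auto
    ultimately have "halts_within (decomposition_algorithm xs Query)
        ((2 * length xs - 1) * call_cost (poly q ?N) ?N)
        (decomposition_output step2_by_linear_minimization (set xs) p)"
      by (rule halts_decomposition_algorithm)
    then obtain z k where z: "exec p sfm q (decomposition_algorithm xs Query) = Some (z, k)"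
      "k \<le> (2 * card S - 1) * call_cost (poly q ?N) ?N"
      "decomposition_output step2_by_linear_minimization S p z"
      unfolding halts_within_def len S(3) by (elim exE conjE)
    have "decomposition_output step2_condition S p z"
      using z(3) by (rule decomposition_output_mono) (simp add: step2_by_linear_minimization_def)
    moreover have "k \<le> poly r (card S)"
      unfolding r by (rule order_trans[OF z(2)]) (intro mult_le_mono1, simp)
    ultimately show ?thesis using z optimal[OF S(1,5)] by blast
  qed
  then show ?thesis using optimal by blast
qed

end
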